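(* Let $\gamma$ be a meromorphic function on $\mathbf{C}$ and let $k$ be a real number. Suppose that $L_1$ and $L_2$ are meromorphic functions on $\mathbf{C}$ such that for each $i\in\{1,2\}$: (i) there exist a meromorphic function $L_i^*$ on $\mathbf{C}$ and a positive real number $N_i$ such that $L_i(k-s)=N_i^s\,\gamma(s)\,L_i^*(s)$ for all $s\in\mathbf{C}$; (ii) there exists a polynomial $P_i$ such that $P_iL_i$ is holomorphic on $\mathbf{C}$ and of finite order in $\mathbf{C}$. Assume further that $L_1/L_2$ has only finitely many poles and that both $L_1/L_2$ and $L_1^*/L_2^*$ are represented by ordinary Dirichlet series. Then there exist a positive integer $N$ and complex numbers $(a_u)_{u\mid N}$ (indexed by the positive divisors $u$ of $N$) such that $$L_1(s)=\Big(\sum_{u\mid N}\frac{a_u}{u^s}\Big)L_2(s)\qquad\text{for all } s\in\mathbf{C}.$$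
   Context: A meromorphic function $f$ on $\mathbf{C}$ is represented by an ordinary Dirichlet series (ODS) if there is a sequence of complex numbers $(a_n)_{n\ge1}$ such that $f(s)=\sum_{n=1}^\infty a_n n^{-s}$ (with the series convergent) for all $s$ with $\operatorname{Re}(s)$ sufficiently large. A function $h$ is of finite order in a set $\Omega\subseteq\mathbf{C}$ if there exist $\rho>0$ and $C>0$ with $|h(s)|\le C e^{|s|^{\rho}}$ for all $s\in\Omega$. *)

theory Defs
  imports "HOL-Complex_Analysis.Complex_Analysis"
begin

(* A meromorphic function on the plane is modelled by f with f nicely_meromorphic_on UNIV: removable
   singularities are filled in and f = 0 at the poles, so that two such functions are equal as
   meromorphic functions iff they are equal as HOL functions.  The pointwise product or quotient of
   such functions can have wrong values at isolated points (a zero meeting a pole); remove_sings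
   turns it into the product or quotient in the field of meromorphic functions. *)

definition mero_quot :: "(complex \<Rightarrow> complex) \<Rightarrow> (complex \<Rightarrow> complex) \<Rightarrow> complex \<Rightarrow> complex" where
  "mero_quot f g = remove_sings (\<lambda>s. f s / g s)"

definition mero_mult :: "(complex \<Rightarrow> complex) \<Rightarrow> (complex \<Rightarrow> complex) \<Rightarrow> complex \<Rightarrow> complex" where
  "mero_mult f g = remove_sings (\<lambda>s. f s * g s)"

definition represented_by_ODS :: "(complex \<Rightarrow> complex) \<Rightarrow> bool" where
  "represented_by_ODS f \<longleftrightarrow>
     (\<exists>(a :: nat \<Rightarrow> complex) (\<sigma> :: real). \<forall>s. Re s > \<sigma> \<longrightarrow>
        (\<lambda>n. a (Suc n) * of_nat (Suc n) powr (-s)) sums f s)"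

definition finite_order_on :: "(complex \<Rightarrow> complex) \<Rightarrow> complex set \<Rightarrow> bool" where
  "finite_order_on h \<Omega> \<longleftrightarrow>
     (\<exists>\<rho>>0. \<exists>C>0. \<forall>s\<in>\<Omega>. norm (h s) \<le> C * exp (norm s powr \<rho>))"

end

theory Submission
  imports Defs "HOL-Real_Asymp.Real_Asymp"
begin

text \<open>
  Let \<open>F = L\<^sub>1/L\<^sub>2\<close>, \<open>G = L\<^sub>1\<^sup>*/L\<^sub>2\<^sup>*\<close> and \<open>Q = N\<^sub>1/N\<^sub>2\<close>, so that \<open>F(k - s) = Q\<^sup>s G(s)\<close>. Far to the right,
  \<open>F\<close> is a Dirichlet series with frequencies \<open>n\<close>; far to the left it is a Dirichlet series in the
  frequencies \<open>Q/m\<close>. Subtract the terms with \<open>n \<le> Q\<close>, multiply by \<open>y\<^sup>s\<close> with \<open>Q < y < \<lfloor>Q\<rfloor> + 1\<close> and by a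
  polynomial that clears the poles. The resulting entire function has at most polynomial growth
  outside a vertical strip and decays along the positive real axis. It has finite order, because an
  entire quotient of functions of finite order has finite order, so by the Phragmen-Lindelof
  principle it is a polynomial, hence zero. Thus \<open>F\<close> is a Dirichlet polynomial over \<open>n \<le> Q\<close>, and
  comparing frequencies with the series of \<open>G\<close> shows that \<open>a\<^sub>n \<noteq> 0\<close> forces \<open>Q/n\<close> to be an integer.
\<close>

section \<open>Entire quotients of functions of finite order\<close>

text \<open>The Cayley transform centred at \<open>w\<close> takes the right half-plane to the unit
  disc. The preimage of the disc of radius 1/2 is a Euclidean disc whose rightmost point has real
  part (1 + 1/2) / (1 - 1/2) = 3 times \<open>Re w\<close>.\<close>

lemma norm_quotient_le_half_imp:
  fixes u w :: complex
  assumes "norm (u - w) \<le> norm (u + cnj w) / 2" "Re u > 0" "Re w > 0"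
  shows "Re u \<le> 3 * Re w"
proof -
  have "(norm (u - w))\<^sup>2 \<le> (norm (u + cnj w) / 2)\<^sup>2"
    using assms(1) by (intro power_mono) auto
  hence "(Re u - Re w)\<^sup>2 + (Im u - Im w)\<^sup>2 \<le> ((Re u + Re w)\<^sup>2 + (Im u - Im w)\<^sup>2) / 4"
    by (simp add: cmod_power2 power_divide)
  moreover have "(Im u - Im w)\<^sup>2 \<ge> 0" by (rule zero_le_power2)
  \<comment> \<open>Used with \<open>x\<close> and \<open>t\<close> the squares of
    \<open>Re u - Re w\<close> and \<open>Re u + Re w\<close>, and \<open>y\<close> the square of
    \<open>Im u - Im w\<close>.\<close>
  moreover have "4 * x \<le> t" if "x + y \<le> (t + y) / 4" "0 \<le> y" for x y t :: real
    using that by (simp add: field_simps)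
  ultimately have "4 * (Re u - Re w)\<^sup>2 \<le> (Re u + Re w)\<^sup>2"
    by blast
  hence "(2 * (Re u - Re w))\<^sup>2 \<le> (Re u + Re w)\<^sup>2"
    unfolding power_mult_distrib by simp
  hence "2 * (Re u - Re w) \<le> Re u + Re w"
    by (rule power2_le_imp_le) (use assms(2,3) in linarith)
  thus ?thesis by simp
qed

text \<open>The Schwarz lemma is applied to a Cayley transform of the right half-plane.\<close>
lemma harnack_half_ball:
  assumes holo: "g holomorphic_on ball 0 r" and pos: "\<And>z. z \<in> ball 0 r \<Longrightarrow> Re (g z) > 0"
    and z: "norm z \<le> r / 2" and r: "r > 0"
  shows "Re (g z) \<le> 3 * Re (g 0)"
proof -
  define \<phi> where "\<phi> w = (g (r * w) - g 0) / (g (r * w) + cnj (g 0))" for w :: complex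
  have in_ball: "of_real r * w \<in> ball 0 r" if "norm w < 1" for w :: complex
    using that r by (simp add: norm_mult)
  have Re0: "Re (g 0) > 0" using pos[of 0] r by simp
  have less: "norm (u - g 0) < norm (u + cnj (g 0))" if "Re u > 0" for u
  proof -
    have "(Re u - Re (g 0))\<^sup>2 < (Re u + Re (g 0))\<^sup>2"
      using that Re0 by (simp add: power2_eq_square algebra_simps)
    hence "(norm (u - g 0))\<^sup>2 < (norm (u + cnj (g 0)))\<^sup>2"
      by (simp add: cmod_power2)
    thus ?thesis by (simp add: power2_less_imp_less)
  qed
  have nz: "g (r * w) + cnj (g 0) \<noteq> 0" if "norm w < 1" for w :: complex
    using less[OF pos[OF in_ball[OF that]]] by auto
  have zr: "norm (z / r) < 1" using z r by (simp add: norm_divide)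
  moreover have "\<phi> holomorphic_on ball 0 1"
    unfolding \<phi>_def using in_ball nz
    by (auto intro!: holomorphic_intros holomorphic_on_compose_gen[OF _ holo, unfolded o_def])
  moreover have "norm (\<phi> w) < 1" if "norm w < 1" for w :: complex
    using less[OF pos[OF in_ball[OF that]]] nz[OF that] by (simp add: \<phi>_def norm_divide)
  ultimately have "norm (\<phi> (z / r)) \<le> norm (z / r)"
    by (intro Schwarz_Lemma(1)) (simp_all add: \<phi>_def[of 0])
  also have "\<dots> \<le> 1 / 2" using z r by (simp add: norm_divide field_simps)
  finally have "norm (g z - g 0) \<le> norm (g z + cnj (g 0)) / 2"
    using nz[OF zr] r by (simp add: \<phi>_def norm_divide field_simps)
  thus ?thesis
    by (rule norm_quotient_le_half_imp) (use pos z r Re0 in auto)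
qed

text \<open>A zero-free \<open>f\<close> on a disc is \<open>exp g\<close>, and the strict bound by
  \<open>B\<close> makes the real part of \<open>ln B - g\<close> positive. The Harnack inequality
  bounds \<open>ln B - ln (norm (f z))\<close> by three times its value at 0; exponentiating gives
  the claim.\<close>

lemma zero_free_lower_bound:
  assumes holo: "f holomorphic_on ball 0 r" and nz: "\<And>z. z \<in> ball 0 r \<Longrightarrow> f z \<noteq> 0"
    and bd: "\<And>z. z \<in> ball 0 r \<Longrightarrow> norm (f z) < B"
    and z: "norm z \<le> r / 2" and r: "r > 0"
  shows "norm (f 0) ^ 3 / B ^ 2 \<le> norm (f z)"
proof -
  have f0: "f 0 \<noteq> 0" using nz r by simp
  have B: "B > 0" using bd[of 0] r by (smt (verit) centre_in_ball norm_ge_zero)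
  obtain g where g: "g holomorphic_on ball 0 r" "\<And>z. z \<in> ball 0 r \<Longrightarrow> f z = exp (g z)"
    using contractible_imp_holomorphic_log[OF holo] nz convex_imp_contractible[OF convex_ball]
    by metis
  have Re_g: "Re (g w) = ln (norm (f w))" if "w \<in> ball 0 r" for w
    using g(2)[OF that] by simp
  have "Re (ln B - g z) \<le> 3 * Re (ln B - g 0)"
  proof (rule harnack_half_ball[OF _ _ z r])
    show "(\<lambda>w. ln B - g w) holomorphic_on ball 0 r"
      by (intro holomorphic_intros g)
    show "Re (ln B - g w) > 0" if "w \<in> ball 0 r" for w
      using bd[OF that] nz[OF that] B Re_g[OF that] by simp
  qed
  moreover have "z \<in> ball 0 r" "(0::complex) \<in> ball 0 r" using z r by auto
  ultimately have "3 * ln (norm (f 0)) - 2 * ln B \<le> ln (norm (f z))"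
    using B by (simp add: Re_g)
  hence "exp (3 * ln (norm (f 0)) - 2 * ln B) \<le> norm (f z)"
    using \<open>z \<in> ball 0 r\<close> nz by (metis exp_le_cancel_iff exp_ln zero_less_norm_iff)
  also have "exp (3 * ln (norm (f 0)) - 2 * ln B) = norm (f 0) ^ 3 / B ^ 2"
    using f0 B by (simp add: exp_diff exp_of_nat_mult[of 3, simplified] exp_of_nat_mult[of 2, simplified])
  finally show ?thesis .
qed

lemma max_modulus_cball:
  assumes "f holomorphic_on UNIV" "\<And>z. norm z = R \<Longrightarrow> norm (f z) \<le> B" "R > 0" "norm z \<le> R"
  shows "norm (f z) \<le> B"
proof (rule maximum_modulus_frontier[of f "cball 0 R"])
  show "f holomorphic_on interior (cball 0 R)" using assms holomorphic_on_subset by blast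
  show "continuous_on (closure (cball 0 R)) f"
    using assms holomorphic_on_imp_continuous_on continuous_on_subset by blast
qed (use assms in auto)

text \<open>Induction on the number of zeros of \<open>f\<close> in the half-size disc: a zero is traded for the
  inverse of a Blaschke factor, which has modulus one on the sphere and at least doubles
  \<open>norm (f 0)\<close>. Hence the process stops.\<close>
lemma entire_quotient_bound:
  assumes "f holomorphic_on UNIV" "h holomorphic_on UNIV" "f 0 \<noteq> 0" "R > 0"
    and "\<And>z. norm z = R \<Longrightarrow> norm (f z) \<le> B"
    and "\<And>z. norm z = R \<Longrightarrow> norm (f z * h z) \<le> B1"
    and "norm z \<le> R / 4"
  shows "norm (h z) \<le> B1 * (2 * B) ^ 2 / norm (f 0) ^ 3"
proof -
  \<comment> \<open>\<open>n\<close> limits the number of zeros that can be traded: each trade at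
    least doubles \<open>norm (f 0)\<close>, and at \<open>n = 0\<close> the condition
    \<open>B < norm (f 0)\<close> contradicts the maximum principle.\<close>
  have "\<exists>n. B < 2 ^ n * norm (f 0)"
    using real_arch_pow[of 2 "B / norm (f 0)"] assms(3) by (auto simp: field_simps)
  then obtain n where "B < 2 ^ n * norm (f 0)" ..
  thus ?thesis using assms(1,3,5,6)
  proof (induction n arbitrary: f)
    case 0
    thus ?case using max_modulus_cball[OF 0(2,4) assms(4), of 0] assms(4) by simp
  next
    case (Suc n)
    note f = Suc.prems
    have max: "norm (f w) \<le> B" "norm (f w * h w) \<le> B1" if "norm w \<le> R" for w
      using max_modulus_cball[OF f(2,4) assms(4) that]
        max_modulus_cball[OF holomorphic_on_mult[OF f(2) assms(2)] f(5) assms(4) that] by auto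
    have "norm (f 0) > 0" using f(3) by simp
    hence B: "B > 0" using max(1)[of 0] assms(4) by (smt (verit) norm_zero)
    show ?case
    proof (cases "\<exists>a. norm a \<le> R / 2 \<and> f a = 0")
      case True
      then obtain a where a: "norm a \<le> R / 2" "f a = 0" by blast
      hence "a \<noteq> 0" using f(3) by auto
      define q where "q w = (if w = a then deriv f a else (f w - f a) / (w - a))" for w
      have q: "q holomorphic_on UNIV"
        unfolding q_def by (rule pole_lemma_open[OF f(2)]) auto
      have fq: "f w = (w - a) * q w" for w using a by (simp add: q_def)
      \<comment> \<open>\<open>F\<close> is \<open>f\<close> divided by the Blaschke factor
        \<open>R * (w - a) / (R^2 - cnj a * w)\<close>. At 0 this multiplies the modulus by
        \<open>R / norm a\<close>, which is at least 2.\<close>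
      define F where "F w = q w * (R\<^sup>2 - cnj a * w) / R" for w
      have Fn: "norm (F w) = norm (f w)" if "norm w = R" for w
      proof -
        have "of_real (R\<^sup>2) = w * cnj w"
          using that complex_norm_square[of w] by simp
        hence "of_real (R\<^sup>2) - cnj a * w = w * cnj (w - a)" by (simp add: algebra_simps)
        hence "norm (of_real (R\<^sup>2) - cnj a * w) = R * norm (w - a)"
          using that by (metis norm_mult complex_mod_cnj)
        thus ?thesis using assms(4) by (simp add: F_def fq norm_mult norm_divide)
      qed
      have F0: "norm (F 0) \<ge> 2 * norm (f 0)"
      proof -
        have "norm (F 0) = norm (q 0) * R" using assms(4)
          by (simp add: F_def norm_mult norm_divide power2_eq_square)
        moreover have "norm (f 0) = norm a * norm (q 0)" by (simp add: fq norm_mult)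
        moreover have "norm a * norm (q 0) \<le> R / 2 * norm (q 0)"
          using a by (intro mult_right_mono) auto
        ultimately show ?thesis by (simp add: algebra_simps)
      qed
      have "norm (h z) \<le> B1 * (2 * B) ^ 2 / norm (F 0) ^ 3"
      proof (rule Suc.IH)
        have "2 ^ n * (2 * norm (f 0)) \<le> 2 ^ n * norm (F 0)"
          using F0 by (intro mult_left_mono) auto
        thus "B < 2 ^ n * norm (F 0)" using f(1) unfolding power_Suc by linarith
        show "F holomorphic_on UNIV"
          unfolding F_def using q assms(4) by (auto intro!: holomorphic_intros)
        show "F 0 \<noteq> 0" using F0 f(3) by auto
        show "norm (F w) \<le> B" "norm (F w * h w) \<le> B1" if "norm w = R" for w
          using f(4,5)[OF that] Fn[OF that] by (simp_all add: norm_mult)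
      qed
      also have "\<dots> \<le> B1 * (2 * B) ^ 2 / norm (f 0) ^ 3"
      proof (intro divide_left_mono power_mono mult_pos_pos)
        show "norm (f 0) \<le> norm (F 0)" using F0 by (smt (verit) norm_ge_zero)
        have "0 \<le> norm (f 0 * h 0)" by simp
        also have "\<dots> \<le> B1" using assms(4) by (intro max) auto
        finally show "0 \<le> B1 * (2 * B)\<^sup>2" by simp
        show "norm (f 0) ^ 3 > 0" using f(3) by simp
        have "norm (F 0) > 0" using F0 f(3) by (smt (verit) zero_less_norm_iff)
        thus "norm (F 0) ^ 3 > 0" by simp
      qed auto
      finally show ?thesis .
    next
      case False
      \<comment> \<open>The zero-free disc has radius \<open>R / 2\<close>, so the lower bound is
        available for \<open>norm z <= R / 4\<close>. Replacing \<open>B\<close> by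
        \<open>2 * B\<close> makes the upper bound strict.\<close>
      have lower: "norm (f 0) ^ 3 / (2 * B) ^ 2 \<le> norm (f z)"
      proof (rule zero_free_lower_bound[where r = "R / 2"])
        show "f w \<noteq> 0" if "w \<in> ball 0 (R / 2)" for w using that False by auto
        show "norm (f w) < 2 * B" if "w \<in> ball 0 (R / 2)" for w
          using max(1)[of w] that B assms(4) by auto
      qed (use f(2) assms(4,7) holomorphic_on_subset in auto)
      have "norm (f 0) ^ 3 / (2 * B) ^ 2 * norm (h z) \<le> norm (f z) * norm (h z)"
        by (intro mult_right_mono lower) auto
      also have "\<dots> \<le> B1" using max(2)[of z] assms(4,7) by (simp add: norm_mult)
      finally show ?thesis using B f(3) by (simp add: field_simps)
    qed
  qed
qed

section \<open>Closure properties of functions of finite order\<close>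

text \<open>Finite order with a natural exponent. The base \<open>1 + norm s\<close> is at least 1,
  so powers of it increase with the exponent and constant factors can be absorbed into
  \<open>C\<close>.\<close>

definition exp_poly_growth :: "(complex \<Rightarrow> complex) \<Rightarrow> bool" where
  "exp_poly_growth f \<longleftrightarrow> (\<exists>n C. \<forall>s. norm (f s) \<le> exp (C * (1 + norm s) ^ n))"

text \<open>Normalises the constant to be at least 1 and offers every larger exponent, so that two
  functions can be estimated with one common exponent.\<close>

lemma exp_poly_growthE:
  assumes "exp_poly_growth f"
  obtains n C where "C \<ge> 1" "\<And>m s. m \<ge> n \<Longrightarrow> norm (f s) \<le> exp (C * (1 + norm s) ^ m)"
proof -
  obtain n C where *: "\<And>s. norm (f s) \<le> exp (C * (1 + norm s) ^ n)"
    using assms by (auto simp: exp_poly_growth_def)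
  have "norm (f s) \<le> exp (max 1 C * (1 + norm s) ^ m)" if "m \<ge> n" for m s
  proof -
    have "C * (1 + norm s) ^ n \<le> max 1 C * (1 + norm s) ^ n"
      by (intro mult_right_mono) auto
    also have "\<dots> \<le> max 1 C * (1 + norm s) ^ m"
      using that by (intro mult_left_mono power_increasing) auto
    finally show ?thesis using *[of s] by (meson exp_le_cancel_iff order_trans)
  qed
  thus ?thesis by (intro that[of "max 1 C" n]) auto
qed

lemma exp_poly_growthI:
  assumes "\<And>s. norm (f s) \<le> K * exp (C * (1 + norm s) ^ n)" "K > 0"
  shows "exp_poly_growth f"
  unfolding exp_poly_growth_def
proof (intro exI allI)
  fix s :: complex
  have "\<bar>ln K\<bar> * 1 \<le> \<bar>ln K\<bar> * (1 + norm s) ^ n"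
    by (intro mult_left_mono one_le_power) auto
  hence "ln K + C * (1 + norm s) ^ n \<le> (\<bar>ln K\<bar> + C) * (1 + norm s) ^ n"
    by (simp add: algebra_simps)
  hence "exp (ln K + C * (1 + norm s) ^ n) \<le> exp ((\<bar>ln K\<bar> + C) * (1 + norm s) ^ n)"
    by simp
  thus "norm (f s) \<le> exp ((\<bar>ln K\<bar> + C) * (1 + norm s) ^ n)"
    using assms(1)[of s] assms(2) by (simp add: exp_add)
qed

lemma exp_poly_growth_mult:
  assumes "exp_poly_growth f" "exp_poly_growth g"
  shows "exp_poly_growth (\<lambda>s. f s * g s)"
proof -
  obtain n C where f: "\<And>m s. m \<ge> n \<Longrightarrow> norm (f s) \<le> exp (C * (1 + norm s) ^ m)"
    using exp_poly_growthE[OF assms(1)] by metis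
  obtain m D where g: "\<And>n s. n \<ge> m \<Longrightarrow> norm (g s) \<le> exp (D * (1 + norm s) ^ n)"
    using exp_poly_growthE[OF assms(2)] by metis
  show ?thesis
  proof (rule exp_poly_growthI[where K = 1 and C = "C + D" and n = "n + m"])
    fix s :: complex
    have "norm (f s * g s) \<le> exp (C * (1 + norm s) ^ (n + m)) * exp (D * (1 + norm s) ^ (n + m))"
      unfolding norm_mult by (intro mult_mono f g) auto
    thus "norm (f s * g s) \<le> 1 * exp ((C + D) * (1 + norm s) ^ (n + m))"
      by (simp add: exp_add algebra_simps)
  qed auto
qed

lemma exp_poly_growth_diff:
  assumes "exp_poly_growth f" "exp_poly_growth g"
  shows "exp_poly_growth (\<lambda>s. f s - g s)"
proof -
  obtain n C where f: "C \<ge> 1" "\<And>m s. m \<ge> n \<Longrightarrow> norm (f s) \<le> exp (C * (1 + norm s) ^ m)"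
    using exp_poly_growthE[OF assms(1)] by metis
  obtain m D where g: "D \<ge> 1" "\<And>n s. n \<ge> m \<Longrightarrow> norm (g s) \<le> exp (D * (1 + norm s) ^ n)"
    using exp_poly_growthE[OF assms(2)] by metis
  show ?thesis
  proof (rule exp_poly_growthI[where K = 2 and C = "C + D" and n = "n + m"])
    fix s :: complex
    have "norm (f s - g s) \<le> norm (f s) + norm (g s)" by (rule norm_triangle_ineq4)
    also have "\<dots> \<le> exp (C * (1 + norm s) ^ (n + m)) + exp (D * (1 + norm s) ^ (n + m))"
      by (intro add_mono f g) auto
    also have "\<dots> \<le> exp ((C + D) * (1 + norm s) ^ (n + m)) + exp ((C + D) * (1 + norm s) ^ (n + m))"
      using f(1) g(1) by (intro add_mono) (auto intro!: mult_right_mono)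
    finally show "norm (f s - g s) \<le> 2 * exp ((C + D) * (1 + norm s) ^ (n + m))"
      by simp
  qed auto
qed

lemma finite_order_on_imp_exp_poly_growth:
  assumes "finite_order_on f UNIV"
  shows "exp_poly_growth f"
proof -
  obtain \<rho> C where \<rho>: "\<rho> > 0" "C > 0" "\<And>s. norm (f s) \<le> C * exp (norm s powr \<rho>)"
    using assms by (auto simp: finite_order_on_def)
  show ?thesis
  proof (rule exp_poly_growthI[where K = C and C = 1 and n = "nat \<lceil>\<rho>\<rceil>"])
    fix s :: complex
    have "norm s powr \<rho> \<le> (1 + norm s) powr \<rho>"
      using \<rho>(1) by (intro powr_mono2) auto
    also have "\<dots> \<le> (1 + norm s) powr real (nat \<lceil>\<rho>\<rceil>)"
      by (intro powr_mono real_nat_ceiling_ge) auto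
    also have "\<dots> = (1 + norm s) ^ nat \<lceil>\<rho>\<rceil>"
      by (rule powr_realpow) (smt (verit) norm_ge_zero)
    finally have "C * exp (norm s powr \<rho>) \<le> C * exp (1 * (1 + norm s) ^ nat \<lceil>\<rho>\<rceil>)"
      using \<rho>(2) by (intro mult_left_mono) auto
    thus "norm (f s) \<le> C * exp (1 * (1 + norm s) ^ nat \<lceil>\<rho>\<rceil>)"
      using \<rho>(3)[of s] by linarith
  qed fact
qed

lemma norm_poly_le:
  fixes p :: "complex poly"
  obtains K where "K > 0" "\<And>s. norm (poly p s) \<le> K * (1 + norm s) ^ degree p"
proof
  show "1 + (\<Sum>i\<le>degree p. norm (coeff p i)) > 0"
    by (intro add_pos_nonneg sum_nonneg) auto
  fix s :: complex
  have "norm (poly p s) \<le> (\<Sum>i\<le>degree p. norm (coeff p i * s ^ i))"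
    unfolding poly_altdef by (rule norm_sum)
  also have "\<dots> \<le> (\<Sum>i\<le>degree p. norm (coeff p i) * (1 + norm s) ^ degree p)"
  proof (intro sum_mono)
    fix i assume i: "i \<in> {..degree p}"
    have "norm s ^ i \<le> (1 + norm s) ^ i" by (intro power_mono) auto
    also have "\<dots> \<le> (1 + norm s) ^ degree p" using i by (intro power_increasing) auto
    finally show "norm (coeff p i * s ^ i) \<le> norm (coeff p i) * (1 + norm s) ^ degree p"
      by (simp add: norm_mult norm_power mult_left_mono)
  qed
  also have "\<dots> \<le> (1 + (\<Sum>i\<le>degree p. norm (coeff p i))) * (1 + norm s) ^ degree p"
    by (simp add: distrib_right flip: sum_distrib_right)
  finally show "norm (poly p s) \<le> (1 + (\<Sum>i\<le>degree p. norm (coeff p i))) * (1 + norm s) ^ degree p" .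
qed

lemma exp_poly_growth_poly: "exp_poly_growth (poly p)"
proof -
  obtain K where "\<And>s. norm (poly p s) \<le> K * (1 + norm s) ^ degree p"
    using norm_poly_le by metis
  hence "norm (poly p s) \<le> exp (K * (1 + norm s) ^ degree p)" for s
    by (smt (verit) exp_ge_add_one_self)
  thus ?thesis unfolding exp_poly_growth_def by blast
qed

lemma norm_of_real_powr: "x > 0 \<Longrightarrow> norm (of_real x powr s :: complex) = x powr Re s"
  by (simp add: norm_powr_real_powr)

lemma exp_poly_growth_powr:
  assumes "x > 0"
  shows "exp_poly_growth (\<lambda>s. of_real x powr (- s))" "exp_poly_growth (\<lambda>s. of_real x powr s)"
proof -
  have "\<bar>ln x * Re s\<bar> \<le> \<bar>ln x\<bar> * (1 + norm s)" for s :: complex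
    using abs_Re_le_cmod[of s] unfolding abs_mult by (intro mult_left_mono) auto
  hence "norm (of_real x powr s :: complex) \<le> exp (\<bar>ln x\<bar> * (1 + norm s))" for s :: complex
    using assms by (simp add: norm_of_real_powr powr_def abs_le_iff mult.commute)
  from this this[of "- s" for s] show
    "exp_poly_growth (\<lambda>s. of_real x powr (- s))" "exp_poly_growth (\<lambda>s. of_real x powr s)"
    unfolding exp_poly_growth_def by (auto intro!: exI[of _ 1] exI[of _ "\<bar>ln x\<bar>"])
qed

lemma exp_poly_growth_sum:
  assumes "finite I" "\<And>i. i \<in> I \<Longrightarrow> exp_poly_growth (f i)"
  shows "exp_poly_growth (\<lambda>s. \<Sum>i\<in>I. f i s)"
  using assms
proof (induction I)
  case empty
  have "exp_poly_growth (\<lambda>s. poly 0 s)" by (rule exp_poly_growth_poly)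
  thus ?case by simp
next
  case (insert i I)
  \<comment> \<open>A sum is written as a difference, with the constant polynomial -1 as a factor,
    to reuse closure under differences and products.\<close>
  have "exp_poly_growth (\<lambda>s. f i s - poly [:-1:] s * (\<Sum>i\<in>I. f i s))"
    by (intro exp_poly_growth_diff exp_poly_growth_mult exp_poly_growth_poly insert) auto
  thus ?case using insert.hyps by simp
qed

text \<open>After moving \<open>z0\<close> to the origin, \<open>entire_quotient_bound\<close> is
  applied on a circle whose radius grows linearly in \<open>norm z\<close>. The resulting bound is a
  constant times an exponential of a power of \<open>1 + norm z\<close>.\<close>

lemma exp_poly_growth_quotient:
  assumes f: "f holomorphic_on UNIV" and h: "h holomorphic_on UNIV" and z0: "f z0 \<noteq> 0"
    and gf: "exp_poly_growth f" and gfh: "exp_poly_growth (\<lambda>s. f s * h s)"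
  shows "exp_poly_growth h"
proof -
  obtain n1 C where C: "C \<ge> 1" "\<And>m s. m \<ge> n1 \<Longrightarrow> norm (f s) \<le> exp (C * (1 + norm s) ^ m)"
    using exp_poly_growthE[OF gf] by metis
  obtain n2 D where D: "D \<ge> 1" "\<And>m s. m \<ge> n2 \<Longrightarrow> norm (f s * h s) \<le> exp (D * (1 + norm s) ^ m)"
    using exp_poly_growthE[OF gfh] by metis
  define n where "n = n1 + n2"
  define K where "K = 5 * (1 + norm z0)"
  show ?thesis
  proof (rule exp_poly_growthI[where K = "4 / norm (f z0) ^ 3" and C = "(D + 2 * C) * K ^ n" and n = n])
    fix z :: complex
    \<comment> \<open>The factor 4 ensures \<open>norm (z - z0) <= R / 4\<close>. On
      \<open>norm w = R\<close> this gives
      \<open>1 + norm (w + z0) <= 5 + 4 * norm z + 5 * norm z0\<close>, which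
      \<open>K * (1 + norm z)\<close> dominates.\<close>
    define R where "R = 4 * (norm z + norm z0 + 1)"
    define X where "X = (K * (1 + norm z)) ^ n"
    have X: "(1 + norm (w + z0)) ^ n \<le> X" if "norm w = R" for w
    proof -
      have "norm (w + z0) \<le> norm w + norm z0" by (rule norm_triangle_ineq)
      moreover have "K * (1 + norm z) = 5 + 5 * norm z + 5 * norm z0 + 5 * (norm z0 * norm z)"
        by (simp add: K_def algebra_simps)
      moreover have "norm z0 * norm z \<ge> 0" "norm z \<ge> 0" by simp_all
      ultimately have "1 + norm (w + z0) \<le> K * (1 + norm z)"
        unfolding that R_def by (smt (verit, best))
      thus ?thesis unfolding X_def by (intro power_mono) auto
    qed
    define f' h' where "f' w = f (w + z0)" and "h' w = h (w + z0)" for w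
    have "norm (h' (z - z0)) \<le>
        exp (D * X) * (2 * exp (C * X))\<^sup>2 / norm (f' 0) ^ 3"
    proof (rule entire_quotient_bound[where f = f' and h = h' and R = R])
      show "f' holomorphic_on UNIV" "h' holomorphic_on UNIV"
        unfolding f'_def h'_def
        by (rule holomorphic_on_compose[unfolded o_def, of "\<lambda>w. w + z0"];
            use f h in \<open>auto intro!: holomorphic_intros intro: holomorphic_on_subset\<close>)+
      show "f' 0 \<noteq> 0" using z0 by (simp add: f'_def)
      show "R > 0" unfolding R_def by (smt (verit) norm_ge_zero)
      show "norm (z - z0) \<le> R / 4" using norm_triangle_ineq4[of z z0] by (simp add: R_def)
      fix w :: complex assume w: "norm w = R"
      have "norm (f (w + z0)) \<le> exp (C * (1 + norm (w + z0)) ^ n)"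
        by (rule C) (simp add: n_def)
      also have "\<dots> \<le> exp (C * X)" using X[OF w] C(1) by simp
      finally show "norm (f' w) \<le> exp (C * X)" by (simp add: f'_def)
      have "norm (f (w + z0) * h (w + z0)) \<le> exp (D * (1 + norm (w + z0)) ^ n)"
        by (rule D) (simp add: n_def)
      also have "\<dots> \<le> exp (D * X)" using X[OF w] D(1) by simp
      finally show "norm (f' w * h' w) \<le> exp (D * X)" by (simp add: f'_def h'_def)
    qed
    also have "\<dots> = 4 / norm (f z0) ^ 3 * exp ((D + 2 * C) * X)"
      by (simp add: f'_def power_mult_distrib exp_add distrib_right mult.assoc flip: exp_double)
    finally show "norm (h z) \<le> 4 / norm (f z0) ^ 3 * exp ((D + 2 * C) * K ^ n * (1 + norm z) ^ n)"
      by (simp add: h'_def X_def power_mult_distrib mult.assoc)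
  qed (use z0 in auto)
qed

section \<open>The Phragmen-Lindelof principle in a strip\<close>

text \<open>The damping factor is \<open>exp (- \<epsilon> cos (s / c))\<close>: on the strip, the real part of \<open>cos (s / c)\<close> grows
  exponentially in \<open>\<bar>Im s\<bar>\<close>, which beats any finite order.\<close>
lemma phragmen_lindelof_strip:
  assumes c: "c > 0" and cont: "continuous_on {s. \<bar>Re s\<bar> \<le> c} f"
    and holo: "f holomorphic_on {s. \<bar>Re s\<bar> < c}"
    and edge: "\<And>s. \<bar>Re s\<bar> = c \<Longrightarrow> norm (f s) \<le> B"
    and growth: "\<And>s. \<bar>Re s\<bar> \<le> c \<Longrightarrow> norm (f s) \<le> exp (C * (1 + norm s) ^ n)" and C: "C \<ge> 0"
    and B: "B > 0" and s: "\<bar>Re s\<bar> \<le> c"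
  shows "norm (f s) \<le> B"
proof -
  \<comment> \<open>On the strip the argument \<open>Re z / c\<close> lies in [-1, 1], inside
    (-pi/2, pi/2), so its cosine is at least \<open>cos 1 > 0\<close>. The real part of
    \<open>cos (z / c)\<close> is this cosine times \<open>cosh (Im z / c)\<close>.\<close>
  define \<kappa> :: real where "\<kappa> = cos 1"
  have \<kappa>: "\<kappa> > 0" unfolding \<kappa>_def by (rule cos_gt_zero) (use pi_gt3 in auto)
  have Re_cos_ge: "Re (cos (z / c)) \<ge> \<kappa> / 2 * exp (\<bar>Im z\<bar> / c)" if "\<bar>Re z\<bar> \<le> c" for z :: complex
  proof -
    have "\<kappa> \<le> cos (\<bar>Re z\<bar> / c)"
      unfolding \<kappa>_def using that c pi_gt3 by (intro cos_monotone_0_pi_le) auto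
    also have "\<dots> = cos (Re z / c)" using c by (simp add: abs_if)
    finally have "\<kappa> * exp (\<bar>Im z\<bar> / c) \<le> cos (Re z / c) * (exp (Im z / c) + exp (- (Im z / c)))"
      using \<kappa> c by (intro mult_mono) (auto simp: abs_if)
    thus ?thesis by (simp add: Re_cos)
  qed
  have bound: "norm (f s) \<le> B * exp (\<epsilon> * Re (cos (s / c)))" if \<epsilon>: "\<epsilon> > 0" for \<epsilon>
  proof -
    define F where "F z = f z * exp (- (\<epsilon> * cos (z / c)))" for z :: complex
    have F_le: "norm (F z) \<le> norm (f z) * exp (- (\<epsilon> * (\<kappa> / 2 * exp (\<bar>Im z\<bar> / c))))"
      if "\<bar>Re z\<bar> \<le> c" for z :: complex
      unfolding F_def norm_mult using Re_cos_ge[OF that] \<epsilon>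
      by (intro mult_left_mono) (auto intro: mult_left_mono)
    \<comment> \<open>The rectangle is taken so high that on its horizontal sides the doubly
      exponential damping brings the growth bound below \<open>B\<close>.\<close>
    have "eventually (\<lambda>T. C * (1 + c + T) ^ n - \<epsilon> * (\<kappa> / 2 * exp (T / c)) \<le> ln B) at_top"
    proof -
      have "filterlim (\<lambda>T. C * (1 + c + T) ^ n - \<epsilon> * (\<kappa> / 2 * exp (T / c))) at_bot at_top"
        using c \<epsilon> \<kappa> by real_asymp
      thus ?thesis by (simp add: filterlim_at_bot)
    qed
    moreover have "eventually (\<lambda>T. T \<ge> \<bar>Im s\<bar>) at_top" by (rule eventually_ge_at_top)
    ultimately obtain T where T: "C * (1 + c + T) ^ n - \<epsilon> * (\<kappa> / 2 * exp (T / c)) \<le> ln B" "T \<ge> \<bar>Im s\<bar>"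
      by (metis (mono_tags, lifting) eventually_conj eventually_happens' trivial_limit_at_top_linorder)
    define S where "S = cbox (Complex (-c) (-T)) (Complex c T)"
    have "norm (F s) \<le> B"
    proof (rule maximum_modulus_frontier[of F S])
      have sub: "S \<subseteq> {s. \<bar>Re s\<bar> \<le> c}" "interior S \<subseteq> {s. \<bar>Re s\<bar> < c}"
        by (auto simp: S_def in_cbox_complex_iff in_box_complex_iff)
      show "F holomorphic_on interior S"
        unfolding F_def using holomorphic_on_subset[OF holo sub(2)] c by (intro holomorphic_intros) auto
      show "continuous_on (closure S) F"
        unfolding F_def using continuous_on_subset[OF cont sub(1)] c
        by (auto simp: S_def intro!: continuous_intros)
      show "bounded S" by (simp add: S_def)
      show "s \<in> S" using s T(2) by (auto simp: S_def in_cbox_complex_iff)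
      fix z assume "z \<in> frontier S"
      hence z: "\<bar>Re z\<bar> \<le> c" "\<bar>Im z\<bar> \<le> T" "\<bar>Re z\<bar> = c \<or> \<bar>Im z\<bar> = T"
        by (auto simp: S_def frontier_def in_cbox_complex_iff in_box_complex_iff)
      from z(3) show "norm (F z) \<le> B"
      proof
        assume "\<bar>Re z\<bar> = c"
        have "norm (F z) \<le> norm (f z) * 1"
          using \<epsilon> \<kappa> by (intro order_trans[OF F_le[OF z(1)]] mult_left_mono) auto
        thus ?thesis using edge[OF \<open>\<bar>Re z\<bar> = c\<close>] by simp
      next
        assume T': "\<bar>Im z\<bar> = T"
        have "norm z \<le> c + T" using cmod_le[of z] z(1,2) by linarith
        hence "(1 + norm z) ^ n \<le> (1 + c + T) ^ n" by (intro power_mono) auto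
        hence "norm (f z) \<le> exp (C * (1 + c + T) ^ n)"
          using C by (intro order_trans[OF growth[OF z(1)]]) (simp add: mult_left_mono)
        hence "norm (F z) \<le> exp (C * (1 + c + T) ^ n) * exp (- (\<epsilon> * (\<kappa> / 2 * exp (T / c))))"
          unfolding T'[symmetric] by (intro order_trans[OF F_le[OF z(1)]] mult_right_mono) auto
        also have "\<dots> = exp (C * (1 + c + T) ^ n - \<epsilon> * (\<kappa> / 2 * exp (T / c)))"
          by (simp flip: exp_add)
        also have "\<dots> \<le> exp (ln B)" using T(1) by simp
        also have "\<dots> = B" using B by simp
        finally show ?thesis .
      qed
    qed
    hence "norm (f s) * exp (- (\<epsilon> * Re (cos (s / c)))) \<le> B"
      by (simp add: F_def norm_mult)
    thus ?thesis by (simp add: exp_minus field_simps)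
  qed
  \<comment> \<open>At the fixed point \<open>s\<close> the damping disappears as
    \<open>\<epsilon>\<close> tends to 0.\<close>
  have "((\<lambda>\<epsilon>. B * exp (\<epsilon> * Re (cos (s / c)))) \<longlongrightarrow> B * exp (0 * Re (cos (s / c)))) (at_right 0)"
    by (intro tendsto_intros)
  hence "norm (f s) \<le> B * exp (0 * Re (cos (s / c)))"
    using bound by (intro tendsto_lowerbound) (auto simp: eventually_at_filter)
  thus ?thesis by simp
qed

text \<open>Dividing by \<open>(s + a) ^ d\<close> turns polynomial growth on the edges of the strip
  into boundedness, so Phragmen-Lindelof extends the polynomial growth to the whole plane. By
  Liouville \<open>E\<close> is a polynomial; as it tends to 0 along the positive reals, it is
  zero.\<close>

lemma entire_eq_0_if_strip_growth:
  assumes holo: "E holomorphic_on UNIV" and growth: "exp_poly_growth E"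
    and c: "c > 0" and K: "K > 0"
    and out: "\<And>s. \<bar>Re s\<bar> \<ge> c \<Longrightarrow> norm (E s) \<le> K * (1 + norm s) ^ d"
    and decay: "\<And>x. x \<ge> c \<Longrightarrow> norm (E (of_real x)) \<le> K * (1 + x) ^ d * \<theta> powr x"
    and \<theta>: "0 < \<theta>" "\<theta> < 1"
  shows "E s = 0"
proof -
  \<comment> \<open>The zero of \<open>s + a\<close> lies at distance 1 to the left of the strip,
    whence \<open>norm (s + a) >= 1\<close> on the strip.\<close>
  define a :: complex where "a = of_real (c + 1)"
  \<comment> \<open>The factor \<open>(c + 3) ^ d\<close> comes from replacing
    \<open>1 + norm s\<close> by \<open>norm (s + a)\<close> on the edges,
    \<open>(c + 2) ^ d\<close> from returning to \<open>1 + norm s\<close> inside.\<close>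
  define K' where "K' = K * (c + 3) ^ d * (c + 2) ^ d"
  have a: "norm (s + a) \<ge> 1" "1 + norm s \<le> (c + 3) * norm (s + a)" if "\<bar>Re s\<bar> \<le> c" for s
  proof -
    show 1: "norm (s + a) \<ge> 1"
      using that abs_Re_le_cmod[of "s + a"] by (simp add: a_def)
    have "norm s \<le> norm (s + a) + norm a"
      by (metis add_diff_cancel_right' norm_triangle_ineq4)
    also have "norm a = c + 1" using c by (simp add: a_def norm_of_real del: of_real_add of_real_1)
    finally show "1 + norm s \<le> (c + 3) * norm (s + a)"
      using mult_left_mono[OF 1, of "c + 2"] c by (simp add: algebra_simps)
  qed
  have a0: "s + a \<noteq> 0" if "\<bar>Re s\<bar> \<le> c" for s using a(1)[OF that] by auto
  obtain n C where C: "C \<ge> 1" "\<And>m s. m \<ge> n \<Longrightarrow> norm (E s) \<le> exp (C * (1 + norm s) ^ m)"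
    using exp_poly_growthE[OF growth] by metis
  have K'_ge: "K \<le> K'"
  proof -
    have "K * 1 * 1 \<le> K'" unfolding K'_def using c K
      by (intro mult_mono one_le_power) auto
    thus ?thesis by simp
  qed
  have strip: "norm (E s) \<le> K' * (1 + norm s) ^ d" if s: "\<bar>Re s\<bar> \<le> c" for s
  proof -
    have "norm (E s / (s + a) ^ d) \<le> K * (c + 3) ^ d"
    proof (rule phragmen_lindelof_strip[OF c _ _ _ _ _ _ s])
      show "continuous_on {s. \<bar>Re s\<bar> \<le> c} (\<lambda>s. E s / (s + a) ^ d)"
        using a0 by (intro continuous_intros holomorphic_on_imp_continuous_on
            holomorphic_on_subset[OF holo]) auto
      show "(\<lambda>s. E s / (s + a) ^ d) holomorphic_on {s. \<bar>Re s\<bar> < c}"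
        using a0 by (intro holomorphic_intros holomorphic_on_subset[OF holo]) auto
      show "K * (c + 3) ^ d > 0" "C \<ge> 0" using c K C(1) by auto
      fix z
      {
        assume z: "\<bar>Re z\<bar> = c"
        have "(1 + norm z) ^ d \<le> ((c + 3) * norm (z + a)) ^ d"
          using a(2)[of z] z by (intro power_mono) auto
        hence "norm (E z) \<le> K * ((c + 3) * norm (z + a)) ^ d"
          using K z by (intro order_trans[OF out] mult_left_mono) auto
        thus "norm (E z / (z + a) ^ d) \<le> K * (c + 3) ^ d"
          using a0[of z] z by (simp add: norm_divide norm_power power_mult_distrib divide_le_eq)
      }
      assume z: "\<bar>Re z\<bar> \<le> c"
      have "norm (E z) / norm (z + a) ^ d \<le> norm (E z) / 1"
        using a(1)[OF z] a0[OF z] by (intro divide_left_mono one_le_power) auto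
      also have "\<dots> \<le> exp (C * (1 + norm z) ^ n)" using C(2)[of n z] by simp
      finally show "norm (E z / (z + a) ^ d) \<le> exp (C * (1 + norm z) ^ n)"
        by (simp add: norm_divide norm_power)
    qed
    hence "norm (E s) \<le> K * (c + 3) ^ d * norm (s + a) ^ d"
      using a0[OF s] by (simp add: norm_divide norm_power divide_le_eq)
    also have "\<dots> \<le> K * (c + 3) ^ d * ((c + 2) * (1 + norm s)) ^ d"
    proof (intro mult_left_mono power_mono)
      have "norm (s + a) \<le> norm s + norm a" by (rule norm_triangle_ineq)
      also have "norm a = c + 1" using c by (simp add: a_def norm_of_real del: of_real_add of_real_1)
      also have "norm s + (c + 1) \<le> (c + 2) * (1 + norm s)"
        using c by (simp add: algebra_simps add_increasing)
      finally show "norm (s + a) \<le> (c + 2) * (1 + norm s)" .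
    qed (use c K in auto)
    finally show ?thesis by (simp add: K'_def power_mult_distrib mult.assoc)
  qed
  have all: "norm (E s) \<le> K' * (1 + norm s) ^ d" for s
  proof (cases "\<bar>Re s\<bar> \<le> c")
    case False
    hence "norm (E s) \<le> K * (1 + norm s) ^ d" by (intro out) auto
    also have "\<dots> \<le> K' * (1 + norm s) ^ d" using K'_ge by (intro mult_right_mono) auto
    finally show ?thesis .
  qed (rule strip)
  define b where "b k = (deriv ^^ k) E 0 / fact k" for k
  define p where "p = (\<Sum>k\<le>d. monom (b k) k)"
  have p: "E z = poly p z" for z
  proof -
    have "E z = (\<Sum>k\<le>d. b k * z ^ k)"
      unfolding b_def
    proof (rule Liouville_polynomial[OF holo, where A = 1 and B = "K' * 2 ^ d"])
      fix z :: complex assume z: "1 \<le> norm z"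
      have "K' * (1 + norm z) ^ d \<le> K' * (2 * norm z) ^ d"
        using z K K'_ge by (intro mult_left_mono power_mono) auto
      thus "norm (E z) \<le> K' * 2 ^ d * norm z ^ d"
        using all[of z] by (simp add: power_mult_distrib mult.assoc)
    qed
    thus ?thesis by (simp add: p_def poly_sum poly_monom)
  qed
  have "((\<lambda>x. K * (1 + x) ^ d * \<theta> powr x) \<longlongrightarrow> 0) at_top"
    using \<theta> by real_asymp
  hence lim0: "((\<lambda>x. E (of_real x)) \<longlongrightarrow> 0) at_top"
    by (rule Lim_null_comparison[rotated])
      (use decay in \<open>auto intro!: eventually_mono[OF eventually_ge_at_top[of c]]\<close>)
  have "degree p = 0"
  proof (rule ccontr)
    assume "degree p \<noteq> 0"
    hence "filterlim (poly p) at_infinity at_infinity" by (intro filterlim_poly_at_infinity) auto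
    moreover have "filterlim (of_real :: real \<Rightarrow> complex) at_infinity at_top"
      by (rule filterlim_of_real_at_infinity)
    ultimately have "filterlim (\<lambda>x. poly p (of_real x)) at_infinity at_top"
      by (rule filterlim_compose)
    thus False
      using not_tendsto_and_filterlim_at_infinity[OF _ lim0] p by simp
  qed
  then obtain e where "p = [:e:]" by (elim degree_eq_zeroE)
  hence "E = (\<lambda>_. e)" using p by auto
  thus ?thesis using lim0 by (simp add: tendsto_const_iff)
qed

section \<open>Dirichlet series\<close>

lemma norm_of_nat_powr: "n > 0 \<Longrightarrow> norm (of_nat n powr s :: complex) = real n powr Re s"
  using norm_of_real_powr[of "real n"] by simp

text \<open>Convergence at one point bounds the terms there, which gives absolute convergence at a
  point \<open>c\<close> further right. For \<open>Re s >= c\<close>, every term beyond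
  \<open>X\<close> is at most \<open>(X + 1) powr (c - Re s)\<close> times its size at
  \<open>c\<close>.\<close>

lemma dirichlet_series_tail_bound:
  fixes a :: "nat \<Rightarrow> complex"
  assumes "\<And>s. Re s > \<sigma> \<Longrightarrow> (\<lambda>n. a (Suc n) * of_nat (Suc n) powr (-s)) sums f s"
  obtains C c where "C > 0" "\<And>s. Re s \<ge> c \<Longrightarrow>
    norm (f s - (\<Sum>n\<in>{1..X}. a n * of_nat n powr (-s))) \<le> C * (real X + 1) powr (- Re s)"
proof -
  define tm where "tm s n = a (Suc n) * of_nat (Suc n) powr (-s)" for s n
  \<comment> \<open>The terms are bounded at \<open>\<sigma> + 1\<close>; two more units supply the
    summable factor \<open>n powr (-2)\<close>.\<close>
  define c where "c = \<sigma> + 3"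
  define t where "t n = norm (a (Suc n)) * real (Suc n) powr (- c)" for n
  have norm_tm: "norm (tm s n) = norm (a (Suc n)) * real (Suc n) powr (- Re s)" for s n
    unfolding tm_def norm_mult by (subst norm_of_nat_powr) auto
  have "summable (tm (of_real (\<sigma> + 1)))"
    using assms[of "of_real (\<sigma> + 1)"] sums_summable unfolding tm_def by auto
  then obtain B where "\<And>n. norm (tm (of_real (\<sigma> + 1)) n) \<le> B"
    using summable_imp_Bseq unfolding Bseq_def by blast
  hence B: "norm (a (Suc n)) * real (Suc n) powr (- (\<sigma> + 1)) \<le> B" for n
    unfolding norm_tm by simp
  have t: "summable t"
  proof (rule summable_comparison_test')
    have "summable (\<lambda>n. real n powr (-2))" by (subst summable_real_powr_iff) auto
    hence "summable (\<lambda>n. real (Suc n) powr (-2))" by (subst summable_Suc_iff)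
    thus "summable (\<lambda>n. B * real (Suc n) powr (-2))" by (rule summable_mult)
    fix n :: nat
    have "t n = norm (a (Suc n)) * real (Suc n) powr (- (\<sigma> + 1)) * real (Suc n) powr (-2)"
      by (simp add: t_def c_def mult.assoc algebra_simps flip: powr_add)
    also have "\<dots> \<le> B * real (Suc n) powr (-2)" by (intro mult_right_mono B) auto
    finally show "norm (t n) \<le> B * real (Suc n) powr (-2)" by (simp add: t_def)
  qed
  have t_nonneg: "t n \<ge> 0" for n by (simp add: t_def)
  have "norm (f s - (\<Sum>n\<in>{1..X}. a n * of_nat n powr (-s)))
      \<le> (1 + suminf t) * (real X + 1) powr c * (real X + 1) powr (- Re s)" if s: "Re s \<ge> c" for s
  proof -
    have "(\<lambda>n. tm s (n + X)) sums (f s - (\<Sum>n<X. tm s n))"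
      using s assms[of s] by (intro sums_split_initial_segment) (auto simp: tm_def c_def)
    moreover have "(\<Sum>n<X. tm s n) = (\<Sum>n\<in>{1..X}. a n * of_nat n powr (-s))"
      by (simp add: tm_def sum.atLeast1_atMost_eq)
    ultimately have sums: "(\<lambda>n. tm s (n + X)) sums (f s - (\<Sum>n\<in>{1..X}. a n * of_nat n powr (-s)))"
      by simp
    have tX: "summable (\<lambda>n. t (n + X))" using t by (subst summable_iff_shift)
    have le: "norm (tm s (n + X)) \<le> (real X + 1) powr (c - Re s) * t (n + X)" for n
    proof -
      have "norm (tm s (n + X)) = norm (a (Suc (n + X))) * (real (Suc (n + X)) powr (c - Re s) * real (Suc (n + X)) powr (- c))"
        unfolding norm_tm by (simp flip: powr_add)
      also have "\<dots> \<le> norm (a (Suc (n + X))) * ((real X + 1) powr (c - Re s) * real (Suc (n + X)) powr (- c))"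
        using s by (intro mult_left_mono mult_right_mono powr_mono2') auto
      also have "\<dots> = (real X + 1) powr (c - Re s) * t (n + X)" by (simp add: t_def)
      finally show ?thesis .
    qed
    have "norm (\<Sum>n. tm s (n + X)) \<le> (\<Sum>n. (real X + 1) powr (c - Re s) * t (n + X))"
      by (rule norm_suminf_le[OF le summable_mult[OF tX]])
    also have "\<dots> = (real X + 1) powr (c - Re s) * (\<Sum>n. t (n + X))" by (rule suminf_mult[OF tX])
    \<comment> \<open>The summand 1 keeps the constant positive even if \<open>t\<close> is
      identically zero.\<close>
    also have "\<dots> \<le> (real X + 1) powr (c - Re s) * (1 + suminf t)"
    proof (intro mult_left_mono)
      have "suminf t = (\<Sum>n. t (n + X)) + (\<Sum>n<X. t n)" by (rule suminf_split_initial_segment[OF t])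
      moreover have "(\<Sum>n<X. t n) \<ge> 0" by (intro sum_nonneg t_nonneg)
      ultimately show "(\<Sum>n. t (n + X)) \<le> 1 + suminf t" by linarith
    qed auto
    also have "\<dots> = (1 + suminf t) * (real X + 1) powr c * (real X + 1) powr (- Re s)"
      by (simp add: powr_diff powr_minus field_simps)
    finally show ?thesis using sums_unique[OF sums] by simp
  qed
  moreover have "(1 + suminf t) * (real X + 1) powr c > 0"
    using suminf_nonneg[OF t t_nonneg] by (intro mult_pos_pos) auto
  ultimately show ?thesis by (intro that[of "(1 + suminf t) * (real X + 1) powr c" c])
qed

text \<open>If some coefficient were nonzero, take the smallest such frequency \<open>\<mu>\<close>.
  Multiplied by \<open>\<mu> powr x\<close>, the sum tends to \<open>d \<mu>\<close>, while the
  bound tends to 0 because \<open>\<mu> < Y\<close>.\<close>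

lemma powr_sum_coeffs_eq_0:
  fixes d :: "real \<Rightarrow> complex"
  assumes fin: "finite \<Lambda>" and \<Lambda>: "\<And>l. l \<in> \<Lambda> \<Longrightarrow> 0 < l \<and> l < Y"
    and bound: "\<And>x. x \<ge> x0 \<Longrightarrow> norm (\<Sum>l\<in>\<Lambda>. d l * of_real (l powr (-x))) \<le> C * Y powr (-x)"
    and l: "l \<in> \<Lambda>"
  shows "d l = 0"
proof (rule ccontr)
  assume "d l \<noteq> 0"
  define S where "S = {l\<in>\<Lambda>. d l \<noteq> 0}"
  have S: "finite S" "S \<noteq> {}" using fin l \<open>d l \<noteq> 0\<close> by (auto simp: S_def)
  define \<mu> where "\<mu> = Min S"
  have \<mu>: "\<mu> \<in> S" "\<And>l. l \<in> S \<Longrightarrow> \<mu> \<le> l"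
    unfolding \<mu>_def using S by auto
  have pos: "0 < \<mu>" "\<mu> < Y" "0 < Y" using \<mu>(1) \<Lambda>[of \<mu>] by (auto simp: S_def)
  have "((\<lambda>x. d l * of_real ((\<mu> / l) powr x)) \<longlongrightarrow> (if l = \<mu> then d \<mu> else 0)) at_top"
    if "l \<in> \<Lambda>" for l
  proof (cases "l \<in> S - {\<mu>}")
    case True
    hence "\<mu> < l" using \<mu>(2)[of l] by auto
    hence "((\<lambda>x. (\<mu> / l) powr x) \<longlongrightarrow> 0) at_top" using pos by real_asymp
    from tendsto_mult_right_zero[OF tendsto_of_real[OF this, where 'a = complex, unfolded of_real_0], of "d l"]
    show ?thesis using True by simp
  next
    case False
    thus ?thesis using pos that by (cases "l = \<mu>") (auto simp: S_def)
  qed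
  hence "((\<lambda>x. \<Sum>l\<in>\<Lambda>. d l * of_real ((\<mu> / l) powr x)) \<longlongrightarrow> (\<Sum>l\<in>\<Lambda>. if l = \<mu> then d \<mu> else 0)) at_top"
    by (rule tendsto_sum)
  moreover have "(\<Sum>l\<in>\<Lambda>. if l = \<mu> then d \<mu> else 0) = d \<mu>"
    using fin \<mu>(1) by (simp add: S_def)
  moreover have "((\<lambda>x. \<Sum>l\<in>\<Lambda>. d l * of_real ((\<mu> / l) powr x)) \<longlongrightarrow> 0) at_top"
  proof (rule Lim_null_comparison)
    show "eventually (\<lambda>x. norm (\<Sum>l\<in>\<Lambda>. d l * of_real ((\<mu> / l) powr x)) \<le> C * (\<mu> / Y) powr x) at_top"
      using eventually_ge_at_top[of x0]
    proof eventually_elim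
      case (elim x)
      have "(\<Sum>l\<in>\<Lambda>. d l * of_real ((\<mu> / l) powr x)) =
          of_real (\<mu> powr x) * (\<Sum>l\<in>\<Lambda>. d l * of_real (l powr (-x)))"
        unfolding sum_distrib_left using \<Lambda> pos
        by (intro sum.cong) (auto simp: powr_divide powr_minus field_simps less_imp_le)
      hence "norm (\<Sum>l\<in>\<Lambda>. d l * of_real ((\<mu> / l) powr x)) =
          \<mu> powr x * norm (\<Sum>l\<in>\<Lambda>. d l * of_real (l powr (-x)))"
        by (simp add: norm_mult)
      also have "\<dots> \<le> \<mu> powr x * (C * Y powr (-x))" using elim by (intro mult_left_mono bound) auto
      also have "\<dots> = C * (\<mu> / Y) powr x" using pos by (simp add: powr_divide powr_minus field_simps)
      finally show ?case .
    qed
    show "((\<lambda>x. C * (\<mu> / Y) powr x) \<longlongrightarrow> 0) at_top" using pos by real_asymp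
  qed
  ultimately have "d \<mu> = 0" using tendsto_unique[OF trivial_limit_at_top_linorder] by metis
  thus False using \<mu>(1) by (simp add: S_def)
qed

text \<open>Version for families in which different indices may share a frequency, as happens when a
  quotient \<open>Q / n\<close> is an integer.\<close>

lemma powr_sum_fibres_eq_0:
  fixes d :: "'i \<Rightarrow> complex"
  assumes fin: "finite I" and \<phi>: "\<And>i. i \<in> I \<Longrightarrow> 0 < \<phi> i \<and> \<phi> i < Y"
    and bound: "\<And>x. x \<ge> x0 \<Longrightarrow> norm (\<Sum>i\<in>I. d i * of_real (\<phi> i powr (-x))) \<le> C * Y powr (-x)"
    and i: "i \<in> I"
  shows "(\<Sum>j | j \<in> I \<and> \<phi> j = \<phi> i. d j) = 0"
proof (rule powr_sum_coeffs_eq_0[where \<Lambda> = "\<phi> ` I" and d = "\<lambda>l. \<Sum>j | j \<in> I \<and> \<phi> j = l. d j"])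
  fix x :: real assume x: "x \<ge> x0"
  have "(\<Sum>l\<in>\<phi> ` I. (\<Sum>j | j \<in> I \<and> \<phi> j = l. d j) * of_real (l powr (-x)))
      = (\<Sum>l\<in>\<phi> ` I. \<Sum>j | j \<in> I \<and> \<phi> j = l. d j * of_real (\<phi> j powr (-x)))"
    by (simp add: sum_distrib_right)
  also have "\<dots> = (\<Sum>j\<in>I. d j * of_real (\<phi> j powr (-x)))"
    using fin by (intro sum.group) auto
  finally show "norm (\<Sum>l\<in>\<phi> ` I. (\<Sum>j | j \<in> I \<and> \<phi> j = l. d j) * of_real (l powr (-x))) \<le> C * Y powr (-x)"
    using bound[OF x] by simp
qed (use fin \<phi> i in auto)

section \<open>Reflected Dirichlet series\<close>

lemma cosparse_reflect:
  fixes k :: complex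
  assumes "\<forall>\<^sub>\<approx>s. P s"
  shows "\<forall>\<^sub>\<approx>s. P (k - s)"
proof -
  have "eventually P (at (k - s))" for s
    using assms by (auto simp: eventually_cosparse_open_eq)
  moreover have "filterlim (\<lambda>w. k - w) (at (k - s)) (at s)" for s
    by (intro filterlim_atI tendsto_intros) (auto simp: eventually_at_filter)
  ultimately show ?thesis
    by (auto simp: eventually_cosparse_open_eq filterlim_iff)
qed

text \<open>Identities between meromorphic functions are known only off a sparse set. An estimate
  derived from them holds on a punctured neighbourhood of each point of \<open>S\<close>, and
  continuity carries it to the point itself.\<close>

lemma cosparse_le_imp_le:
  fixes u v :: "complex \<Rightarrow> real"
  assumes "\<forall>\<^sub>\<approx>s. s \<in> S \<longrightarrow> u s \<le> v s" "open S" "s \<in> S" "isCont u s" "isCont v s"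
  shows "u s \<le> v s"
proof (rule tendsto_le)
  have "eventually (\<lambda>s. s \<in> S \<longrightarrow> u s \<le> v s) (at s)"
    using assms(1) by (auto simp: eventually_cosparse_open_eq)
  moreover have "eventually (\<lambda>s. s \<in> S) (at s)"
    using assms(2,3) by (rule eventually_at_in_open')
  ultimately show "eventually (\<lambda>s. u s \<le> v s) (at s)" by eventually_elim auto
qed (use assms in \<open>auto simp: isCont_def\<close>)

text \<open>Induction on a finite set containing the poles: a factor \<open>(s - p) ^ n\<close>
  removes \<open>p\<close>. Asking only for inclusion in \<open>A\<close> spares any distinction of
  whether \<open>p\<close> really is a pole.\<close>

lemma clear_finite_poles:
  assumes "finite A" "f meromorphic_on UNIV" "{z. is_pole f z} \<subseteq> A"
  shows "\<exists>R h. R \<noteq> 0 \<and> h holomorphic_on UNIV \<and> (\<forall>\<^sub>\<approx>s. h s = poly R s * f s)"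
  using assms
proof (induction A arbitrary: f)
  case empty
  have "\<not> is_pole (remove_sings f) z" for z
  proof -
    have "eventually (\<lambda>s. remove_sings f s = f s) (at z)"
      using eventually_remove_sings_eq[OF empty(1)] by (auto simp: eventually_cosparse_open_eq)
    hence "is_pole (remove_sings f) z \<longleftrightarrow> is_pole f z" by (intro is_pole_cong) auto
    thus ?thesis using empty(2) by blast
  qed
  hence "remove_sings f analytic_on UNIV"
    using remove_sings_nicely_meromorphic[OF empty(1)]
    by (intro nicely_meromorphic_without_singularities) auto
  thus ?case
    using eventually_remove_sings_eq[OF empty(1)]
    by (intro exI[of _ 1] exI[of _ "remove_sings f"]) (auto dest: analytic_imp_holomorphic)
next
  case (insert p A)
  note mero = insert.prems(1)
  \<comment> \<open>At a pole \<open>p\<close> this is the pole order. Otherwise any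
    \<open>n\<close> would do, since the product still has a finite limit.\<close>
  define n where "n = nat (- zorder f p)"
  define g where "g s = poly ([:-p, 1:] ^ n) s * f s" for s
  have g_eq: "g s = (s - p) ^ n * f s" for s by (simp add: g_def)
  have no_pole: "\<not> is_pole g z" if "z \<notin> A" for z
  proof (cases "is_pole f z")
    case True
    hence z: "z = p" using insert.prems(2) that by auto
    have "isolated_singularity_at f p"
      using mero by (meson UNIV_I meromorphic_on_isolated_singularity meromorphic_on_subset subset_UNIV)
    then obtain r where r: "r > 0" "f holomorphic_on ball p r - {p}"
      unfolding isolated_singularity_at_def using analytic_imp_holomorphic by blast
    obtain r' where r': "r' > 0" "zor_poly f p holomorphic_on cball p r'"
      "\<And>w. w \<in> cball p r' - {p} \<Longrightarrow> f w = zor_poly f p w / (w - p) ^ n"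
      using zorder_exist_pole[OF r(2) _ _ True[unfolded z]] r(1) unfolding n_def by auto
    have "eventually (\<lambda>w. w \<in> ball p r' - {p}) (at p)"
      using r'(1) by (intro eventually_at_in_open) auto
    hence "eventually (\<lambda>w. g w = zor_poly f p w) (at p)"
      by eventually_elim (use r'(3) in \<open>auto simp: g_eq\<close>)
    moreover have "zor_poly f p analytic_on {p}"
      using r'(1) holomorphic_on_subset[OF r'(2) ball_subset_cball] by (auto simp: analytic_at_ball)
    ultimately show ?thesis
      using z analytic_at_imp_no_pole is_pole_cong by blast
  next
    case False
    have "not_essential f z" using mero by (meson UNIV_I meromorphic_on_not_essential meromorphic_on_subset subset_UNIV)
    then obtain c where "f \<midarrow>z\<rightarrow> c" using False by (auto simp: not_essential_def)
    hence "g \<midarrow>z\<rightarrow> (z - p) ^ n * c" unfolding g_eq by (intro tendsto_intros)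
    thus ?thesis
      unfolding is_pole_def using not_tendsto_and_filterlim_at_infinity[OF at_neq_bot] by blast
  qed
  have "g meromorphic_on UNIV"
    unfolding g_eq by (intro meromorphic_intros mero)
  moreover have "{z. is_pole g z} \<subseteq> A" using no_pole by auto
  ultimately have "\<exists>R h. R \<noteq> 0 \<and> h holomorphic_on UNIV \<and> (\<forall>\<^sub>\<approx>s. h s = poly R s * g s)"
    by (rule insert.IH)
  then obtain R h where Rh: "R \<noteq> 0" "h holomorphic_on UNIV" "\<forall>\<^sub>\<approx>s. h s = poly R s * g s"
    by blast
  show ?case
  proof (intro exI conjI)
    show "R * [:-p, 1:] ^ n \<noteq> 0" using Rh(1) by simp
    show "\<forall>\<^sub>\<approx>s. h s = poly (R * [:-p, 1:] ^ n) s * f s"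
      using Rh(3) by (simp add: g_def mult.assoc)
  qed fact
qed

lemma cosparse_poly_nonzero:
  assumes "R \<noteq> 0"
  shows "\<forall>\<^sub>\<approx>s::complex. poly R s \<noteq> 0"
  using poly_roots_finite[OF assms] by (simp add: eventually_cosparse finite_imp_sparse)

section \<open>A Dirichlet series that reflects to a Dirichlet series is a Dirichlet
  polynomial\<close>

text \<open>\<open>F\<close> and \<open>G\<close> stand for the two quotients and \<open>Q\<close>
  for \<open>N 1 / N 2\<close>; \<open>R\<close> clears the poles of \<open>F\<close>, and
  \<open>H\<close> is the resulting entire function. The identities are required only off a sparse
  set, since pointwise products can be wrong at isolated points.\<close>

locale reflected_dirichlet_series =
  fixes F G H :: "complex \<Rightarrow> complex" and R :: "complex poly" and Q k \<sigma> :: real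
    and a b :: "nat \<Rightarrow> complex"
  assumes F: "\<And>s. Re s > \<sigma> \<Longrightarrow> (\<lambda>n. a (Suc n) * of_nat (Suc n) powr (-s)) sums F s"
    and G: "\<And>s. Re s > \<sigma> \<Longrightarrow> (\<lambda>n. b (Suc n) * of_nat (Suc n) powr (-s)) sums G s"
    and reflect: "\<forall>\<^sub>\<approx>s. F (of_real k - s) = of_real Q powr s * G s"
    and Q: "Q > 0" and R: "R \<noteq> 0" and H_holo: "H holomorphic_on UNIV"
    and H_growth: "exp_poly_growth H" and H: "\<forall>\<^sub>\<approx>s. H s = poly R s * F s"
begin

text \<open>The cut at the integer part of \<open>Q\<close> leaves a gap between \<open>Q\<close>
  and \<open>X + 1\<close>, the first frequency omitted from \<open>D\<close>. For
  \<open>Q < 1\<close> it gives \<open>X = 0\<close> and \<open>D = 0\<close>.\<close>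

definition X :: nat where "X = nat \<lfloor>Q\<rfloor>"

definition D :: "complex \<Rightarrow> complex" where "D s = (\<Sum>n\<in>{1..X}. a n * of_nat n powr (-s))"

lemma X: "real X \<le> Q" "Q < real X + 1"
  using Q unfolding X_def by linarith+

lemma D_holo: "D holomorphic_on UNIV"
  unfolding D_def by (intro holomorphic_intros) auto

lemma D_growth: "exp_poly_growth D"
proof -
  have "exp_poly_growth (\<lambda>s. a n * of_nat n powr (-s))" if "n \<in> {1..X}" for n
    using exp_poly_growth_mult[OF exp_poly_growth_poly[of "[:a n:]"] exp_poly_growth_powr(1)[of "real n"]] that
    by simp
  thus ?thesis unfolding D_def by (intro exp_poly_growth_sum) auto
qed

text \<open>To the right, \<open>F - D\<close> has size at most a constant times
  \<open>(X + 1) powr (- Re s)\<close>; to the left, at most a constant times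
  \<open>Q powr (- Re s)\<close>. Multiplication by \<open>y powr s\<close> with \<open>y\<close> in
  the gap gives decay on the right and, up to the factor \<open>poly R s\<close>, boundedness on the
  left, so the product \<open>E\<close> vanishes.\<close>

lemma H_eq: "H s = poly R s * D s"
proof -
  define y where "y = (Q + real X + 1) / 2"
  have y: "Q < y" "y < real X + 1" "0 < y" using X Q by (auto simp: y_def)
  define \<theta> where "\<theta> = y / (real X + 1)"
  have \<theta>: "0 < \<theta>" "\<theta> < 1" using y by (auto simp: \<theta>_def)
  define E where "E s = (H s - poly R s * D s) * of_real y powr s" for s
  have holo: "E holomorphic_on UNIV"
    unfolding E_def using y(3) by (intro holomorphic_intros H_holo D_holo) auto
  have growth: "exp_poly_growth E"
    unfolding E_def
    by (intro exp_poly_growth_mult exp_poly_growth_diff exp_poly_growth_poly exp_poly_growth_powr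
        D_growth H_growth y)
  have cont: "isCont (\<lambda>s. norm (E s)) s" for s
    using holo by (intro continuous_intros holomorphic_on_imp_continuous_on continuous_on_interior[of UNIV]) auto
  obtain C1 c1 where C1: "C1 > 0" "\<And>s. Re s \<ge> c1 \<Longrightarrow> norm (F s - D s) \<le> C1 * (real X + 1) powr (- Re s)"
    using dirichlet_series_tail_bound[OF F, where X = X, folded D_def] by blast
  \<comment> \<open>With \<open>X = 0\<close> the subtracted sum is empty and the power is 1, so
    \<open>G\<close> is bounded on a half-plane.\<close>
  obtain C2 c2 where C2: "C2 > 0" "\<And>s. Re s \<ge> c2 \<Longrightarrow> norm (G s) \<le> C2"
    using dirichlet_series_tail_bound[OF G, where X = 0, simplified] by blast
  obtain C0 where C0: "C0 > 0" "\<And>s. norm (poly R s) \<le> C0 * (1 + norm s) ^ degree R"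
    using norm_poly_le by metis
  \<comment> \<open>The added units place \<open>Re s >= c\<close> and \<open>Re s <= -c\<close>
    inside the open half-planes where the estimates hold off a sparse set; the maximum with 1 makes
    \<open>Re s\<close> negative on the left.\<close>
  define c where "c = max 1 (max (c1 + 1) (c2 - k + 1))"
  have c: "c \<ge> 1" "c > c1" "c > c2 - k"
    by (auto simp: c_def)
  define K where "K = C0 * (C1 + (\<Sum>n\<in>{1..X}. norm (a n)) + C2 * Q powr k)"
  have A: "(\<Sum>n\<in>{1..X}. norm (a n)) \<ge> 0" by (intro sum_nonneg) auto
  have B: "C2 * Q powr k \<ge> 0" using C2(1) by simp
  have "K > 0"
    unfolding K_def by (intro mult_pos_pos C0(1) add_pos_nonneg C1(1) A B)
  moreover have "K \<ge> C0 * C1" "K \<ge> C0 * ((\<Sum>n\<in>{1..X}. norm (a n)) + C2 * Q powr k)"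
    unfolding K_def by (intro mult_left_mono; use A B C0(1) C1(1) in linarith)+
  ultimately have K: "K > 0" "K \<ge> C0 * C1" "K \<ge> C0 * ((\<Sum>n\<in>{1..X}. norm (a n)) + C2 * Q powr k)"
    by blast+
  have right: "norm (E s) \<le> K * (1 + norm s) ^ degree R * \<theta> powr Re s" if s: "Re s \<ge> c" for s
  proof -
    have "norm (E s) \<le> norm (poly R s) * (C1 * \<theta> powr Re s)"
    proof (rule cosparse_le_imp_le[where S = "{s. Re s > c1}" and u = "\<lambda>s. norm (E s)"])
      show "\<forall>\<^sub>\<approx>s. s \<in> {s. Re s > c1} \<longrightarrow> norm (E s) \<le> norm (poly R s) * (C1 * \<theta> powr Re s)"
        using H
      proof eventually_elim
        case (elim s)
        show ?case
        proof
          assume "s \<in> {s. Re s > c1}"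
          hence "norm (F s - D s) * y powr Re s \<le> C1 * (real X + 1) powr (- Re s) * y powr Re s"
            by (intro mult_right_mono C1) auto
          also have "\<dots> = C1 * \<theta> powr Re s"
            using y by (simp add: \<theta>_def powr_divide powr_minus field_simps)
          finally have "norm (poly R s) * (norm (F s - D s) * y powr Re s) \<le> norm (poly R s) * (C1 * \<theta> powr Re s)"
            by (intro mult_left_mono) auto
          thus "norm (E s) \<le> norm (poly R s) * (C1 * \<theta> powr Re s)"
            using y(3) by (simp add: E_def elim norm_mult norm_of_real_powr mult.assoc
                flip: right_diff_distrib)
        qed
      qed
      show "isCont (\<lambda>s. norm (poly R s) * (C1 * \<theta> powr Re s)) s"
        using \<theta> by (intro continuous_intros) auto
    qed (use s c cont in \<open>auto simp: open_halfspace_Re_gt\<close>)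
    also have "\<dots> \<le> C0 * (1 + norm s) ^ degree R * (C1 * \<theta> powr Re s)"
      using C1 by (intro mult_right_mono C0) auto
    also have "\<dots> = C0 * C1 * ((1 + norm s) ^ degree R * \<theta> powr Re s)" by simp
    also have "\<dots> \<le> K * ((1 + norm s) ^ degree R * \<theta> powr Re s)"
      by (intro mult_right_mono K) auto
    finally show ?thesis by (simp add: mult.assoc)
  qed
  have left: "norm (E s) \<le> K * (1 + norm s) ^ degree R" if s: "Re s \<le> -c" for s
  proof -
    have "norm (E s) \<le> norm (poly R s) * ((\<Sum>n\<in>{1..X}. norm (a n)) + C2 * Q powr k)"
    proof (rule cosparse_le_imp_le[where S = "{s. Re s < min 0 (k - c2)}" and u = "\<lambda>s. norm (E s)"])
      show "\<forall>\<^sub>\<approx>s. s \<in> {s. Re s < min 0 (k - c2)} \<longrightarrow>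
          norm (E s) \<le> norm (poly R s) * ((\<Sum>n\<in>{1..X}. norm (a n)) + C2 * Q powr k)"
        using H cosparse_reflect[OF reflect, of "of_real k"]
      proof eventually_elim
        case (elim s)
        show ?case
        proof
          assume "s \<in> {s. Re s < min 0 (k - c2)}"
          hence s: "Re s < 0" "Re s < k - c2" by auto
          \<comment> \<open>This is the reflection formula at \<open>k - s\<close>.\<close>
          have "norm (F s) = Q powr (k - Re s) * norm (G (of_real k - s))"
            using elim(2) Q by (simp add: norm_mult norm_of_real_powr)
          also have "\<dots> \<le> Q powr (k - Re s) * C2" using s by (intro mult_left_mono C2) auto
          also have "\<dots> = C2 * Q powr k * Q powr (- Re s)" by (simp add: powr_diff powr_minus field_simps)
          finally have Fs: "norm (F s) \<le> C2 * Q powr k * Q powr (- Re s)" .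
          have "norm (D s) \<le> (\<Sum>n\<in>{1..X}. norm (a n * of_nat n powr (-s)))"
            unfolding D_def by (rule norm_sum)
          also have "\<dots> \<le> (\<Sum>n\<in>{1..X}. norm (a n) * Q powr (- Re s))"
          proof (intro sum_mono)
            fix n assume n: "n \<in> {1..X}"
            hence "real n powr (- Re s) \<le> Q powr (- Re s)"
              using s X(1) by (intro powr_mono2) auto
            thus "norm (a n * of_nat n powr (-s)) \<le> norm (a n) * Q powr (- Re s)"
              using n by (auto simp: norm_mult norm_of_nat_powr intro!: mult_left_mono)
          qed
          finally have "norm (F s - D s) \<le> ((\<Sum>n\<in>{1..X}. norm (a n)) + C2 * Q powr k) * Q powr (- Re s)"
            using Fs norm_triangle_ineq4[of "F s" "D s"] by (simp add: sum_distrib_right distrib_right)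
          also have "\<dots> \<le> ((\<Sum>n\<in>{1..X}. norm (a n)) + C2 * Q powr k) * y powr (- Re s)"
            using A C2 Q s y by (intro mult_left_mono powr_mono2) auto
          finally have "norm (F s - D s) * y powr Re s \<le> (\<Sum>n\<in>{1..X}. norm (a n)) + C2 * Q powr k"
            using y(3) by (simp add: powr_minus field_simps)
          hence "norm (poly R s) * (norm (F s - D s) * y powr Re s)
              \<le> norm (poly R s) * ((\<Sum>n\<in>{1..X}. norm (a n)) + C2 * Q powr k)"
            by (intro mult_left_mono) auto
          thus "norm (E s) \<le> norm (poly R s) * ((\<Sum>n\<in>{1..X}. norm (a n)) + C2 * Q powr k)"
            using y(3) by (simp add: E_def elim(1) norm_mult norm_of_real_powr mult.assoc
                flip: right_diff_distrib)
        qed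
      qed
    qed (use s c cont in \<open>auto simp: open_halfspace_Re_lt open_Collect_conj intro!: continuous_intros\<close>)
    also have "\<dots> \<le> C0 * (1 + norm s) ^ degree R * ((\<Sum>n\<in>{1..X}. norm (a n)) + C2 * Q powr k)"
      using A C2 by (intro mult_right_mono C0) auto
    also have "\<dots> = C0 * ((\<Sum>n\<in>{1..X}. norm (a n)) + C2 * Q powr k) * (1 + norm s) ^ degree R" by simp
    also have "\<dots> \<le> K * (1 + norm s) ^ degree R" by (intro mult_right_mono K) auto
    finally show ?thesis .
  qed
  have "E s = 0"
  proof (rule entire_eq_0_if_strip_growth[OF holo growth _ K(1) _ _ \<theta>])
    show "c > 0" using c by simp
    show "norm (E z) \<le> K * (1 + norm z) ^ degree R" if "\<bar>Re z\<bar> \<ge> c" for z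
    proof (cases "Re z \<ge> c")
      case True
      have "\<theta> powr Re z \<le> 1" using \<theta> True c by (simp add: powr_le1)
      hence "K * (1 + norm z) ^ degree R * \<theta> powr Re z \<le> K * (1 + norm z) ^ degree R * 1"
        using K by (intro mult_left_mono) auto
      thus ?thesis using right[OF True] by simp
    qed (use that left[of z] in auto)
    show "norm (E (of_real x)) \<le> K * (1 + x) ^ degree R * \<theta> powr x" if "x \<ge> c" for x
      using right[of "of_real x"] that c by simp
  qed
  thus ?thesis using y(3) by (simp add: E_def)
qed

lemma F_eq_D: "\<forall>\<^sub>\<approx>s. F s = D s"
  using H cosparse_poly_nonzero[OF R] by eventually_elim (use H_eq in auto)

text \<open>By reflection, \<open>G s\<close> equals \<open>Q powr (-s) * D (k - s)\<close>, a
  finite sum with frequencies \<open>Q / n\<close>. Compared with the first \<open>X\<close> terms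
  of its own series, all frequencies lie below \<open>X + 1\<close> while the difference has the
  size of the tail, so the coefficients at each frequency cancel. A non-integral
  \<open>Q / l\<close> has nothing to cancel with.\<close>

lemma reciprocal_frequency:
  assumes l: "l \<in> {1..X}" "a l \<noteq> 0"
  shows "\<exists>m. Q = real (l * m)"
proof (rule ccontr)
  assume no: "\<nexists>m. Q = real (l * m)"
  \<comment> \<open>The left summand indexes the terms of the reflected \<open>D\<close>, where the
    shift by \<open>k\<close> contributes \<open>n powr (-k)\<close>; the right one indexes the
    terms of \<open>G\<close>, with opposite sign.\<close>
  define d where "d i = (case i of Inl n \<Rightarrow> a n * of_nat n powr (- of_real k) | Inr n \<Rightarrow> - b n)" for i
  define \<phi> where "\<phi> i = (case i of Inl n \<Rightarrow> Q / real n | Inr n \<Rightarrow> real n)" for i :: "nat + nat"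
  define I where "I = {1..X} <+> {1..X}"
  have QX: "Q / real n < real X + 1" if "n \<ge> 1" for n :: nat
  proof -
    have "Q / real n \<le> Q / 1" using that Q by (intro divide_left_mono) auto
    thus ?thesis using X by simp
  qed
  obtain C c where C: "\<And>s. Re s \<ge> c \<Longrightarrow>
      norm (G s - (\<Sum>n\<in>{1..X}. b n * of_nat n powr (-s))) \<le> C * (real X + 1) powr (- Re s)"
    using dirichlet_series_tail_bound[OF G, where X = X] by blast
  \<comment> \<open>Off a sparse set \<open>T\<close> is the tail of the series of \<open>G\<close>.
    Being entire, it satisfies the tail bound at every point with \<open>Re s > c\<close>, in
    particular on the real axis.\<close>
  define T where "T s = of_real Q powr (-s) * D (of_real k - s) - (\<Sum>n\<in>{1..X}. b n * of_nat n powr (-s))" for s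
  have T_holo: "T holomorphic_on UNIV"
    unfolding T_def D_def using Q by (intro holomorphic_intros) auto
  have T_le: "norm (T s) \<le> C * (real X + 1) powr (- Re s)" if "Re s > c" for s
  proof (rule cosparse_le_imp_le[where S = "{s. Re s > c}" and u = "\<lambda>s. norm (T s)"])
    show "\<forall>\<^sub>\<approx>s. s \<in> {s. Re s > c} \<longrightarrow> norm (T s) \<le> C * (real X + 1) powr (- Re s)"
      using reflect cosparse_reflect[OF F_eq_D, of "of_real k"]
    proof eventually_elim
      case (elim s)
      have "of_real Q powr (-s) * (of_real Q powr s * G s) = G s"
        using Q by (simp add: powr_minus)
      hence "T s = G s - (\<Sum>n\<in>{1..X}. b n * of_nat n powr (-s))"
        by (simp add: T_def flip: elim)
      thus ?case using C[of s] by auto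
    qed
    show "isCont (\<lambda>s. norm (T s)) s"
      using T_holo by (intro continuous_intros holomorphic_on_imp_continuous_on continuous_on_interior[of UNIV]) auto
    show "isCont (\<lambda>s. C * (real X + 1) powr (- Re s)) s" by (intro continuous_intros) auto
  qed (use that in \<open>auto simp: open_halfspace_Re_gt\<close>)
  have "(\<Sum>j | j \<in> I \<and> \<phi> j = \<phi> (Inl l). d j) = 0"
  proof (rule powr_sum_fibres_eq_0)
    show "finite I" "Inl l \<in> I" using l by (auto simp: I_def)
    show "0 < \<phi> i \<and> \<phi> i < real X + 1" if "i \<in> I" for i
      using that Q QX by (auto simp: I_def \<phi>_def)
    fix x :: real assume x: "x \<ge> c + 1"
    have eq: "of_real Q powr (- of_real x) * (a n * of_nat n powr (- (of_real k - of_real x))) =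
        a n * of_nat n powr (- of_real k) * of_real ((Q / real n) powr (-x))" if "n \<ge> 1" for n
    proof -
      have "of_real Q powr (- of_real x :: complex) = of_real (Q powr (-x))"
        using powr_of_real[of Q "-x"] Q by simp
      moreover have "of_nat n powr (of_real x :: complex) = of_real (real n powr x)"
        using powr_of_real[of "real n" x] by simp
      ultimately show ?thesis
        using that Q by (simp add: powr_diff powr_minus powr_divide field_simps)
    qed
    have eq': "of_nat n powr (- of_real x :: complex) = of_real (real n powr (-x))" for n
      using powr_of_real[of "real n" "-x"] by simp
    have "of_real Q powr (- of_real x) * D (of_real k - of_real x) =
        (\<Sum>n\<in>{1..X}. d (Inl n) * of_real (\<phi> (Inl n) powr (-x)))"
      unfolding D_def sum_distrib_left by (intro sum.cong refl, subst eq) (auto simp: d_def \<phi>_def)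
    moreover have "- (\<Sum>n\<in>{1..X}. b n * of_nat n powr (- of_real x)) =
        (\<Sum>n\<in>{1..X}. d (Inr n) * of_real (\<phi> (Inr n) powr (-x)))"
      by (simp add: d_def \<phi>_def eq' sum_negf)
    ultimately have "(\<Sum>i\<in>I. d i * of_real (\<phi> i powr (-x))) = T (of_real x)"
      unfolding I_def T_def by (subst sum.Plus) simp_all
    thus "norm (\<Sum>i\<in>I. d i * of_real (\<phi> i powr (-x))) \<le> C * (real X + 1) powr (-x)"
      using T_le[of "of_real x"] x by simp
  qed
  \<comment> \<open>\<open>Q / m = Q / l\<close> forces \<open>m = l\<close>, and an integer equal
    to \<open>Q / l\<close> would make \<open>Q\<close> a multiple of \<open>l\<close>.\<close>
  also have "{j. j \<in> I \<and> \<phi> j = \<phi> (Inl l)} = {Inl l}"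
  proof -
    have "m = l" if "Q / real m = Q / real l" "m \<ge> 1" for m :: nat
      using that l Q by (auto simp: field_simps)
    moreover have "real m \<noteq> Q / real l" for m
      using no l by (auto simp: field_simps)
    ultimately show ?thesis using l by (auto simp: I_def \<phi>_def)
  qed
  finally have "d (Inl l) = 0" by simp
  thus False using l by (simp add: d_def)
qed

text \<open>A single nonzero coefficient of \<open>D\<close> already makes \<open>Q\<close> an
  integer, hence equal to \<open>X\<close>; then every index with nonzero coefficient divides
  \<open>X\<close>, and \<open>M = X\<close> works. If there is none, \<open>M = 1\<close> with zero
  coefficients serves.\<close>

theorem F_eq_divisor_sum:
  "\<exists>(M :: nat) c. M > 0 \<and> (\<forall>\<^sub>\<approx>s. F s = (\<Sum>u | u dvd M. c u / of_nat u powr s))"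
proof (cases "\<exists>l\<in>{1..X}. a l \<noteq> 0")
  case False
  hence "D s = 0" for s by (simp add: D_def)
  thus ?thesis using F_eq_D by (intro exI[of _ 1] exI[of _ "\<lambda>_. 0"]) simp
next
  case True
  then obtain l m where l: "l \<in> {1..X}" and Qlm: "Q = real (l * m)" using reciprocal_frequency by blast
  have "X = l * m" unfolding X_def by (simp only: Qlm floor_of_nat nat_int)
  hence QX: "Q = real X" using Qlm by (simp only:)
  have "X > 0" using l by simp
  have dvd: "l dvd X" if n: "l \<in> {1..X}" "a l \<noteq> 0" for l
  proof -
    obtain m where "Q = real (l * m)" using reciprocal_frequency[OF n] by blast
    hence "real X = real (l * m)" by (rule trans[OF QX[symmetric]])
    hence "X = l * m" by (simp only: of_nat_eq_iff)
    thus ?thesis by simp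
  qed
  have "D s = (\<Sum>u | u dvd X. a u / of_nat u powr s)" for s
  proof -
    have "(\<Sum>u | u dvd X. a u / of_nat u powr s) = (\<Sum>n\<in>{1..X}. a n / of_nat n powr s)"
      using \<open>X > 0\<close> dvd by (intro sum.mono_neutral_left) (auto dest: dvd_imp_le intro!: Suc_leI Nat.gr0I)
    thus ?thesis by (simp add: D_def powr_minus field_simps)
  qed
  thus ?thesis using F_eq_D \<open>X > 0\<close> by (intro exI[of _ X] exI[of _ a]) simp
qed

end

section \<open>Passage to the field of meromorphic functions and the conclusion\<close>

lemma cosparse_UNIV_happens:
  assumes "\<forall>\<^sub>\<approx>s::complex. P s"
  shows "\<exists>s. P s"
  using eventually_happens'[OF _ assms] by simp

lemma continuous_cosparse_eq_imp_eq:
  fixes f g :: "complex \<Rightarrow> complex"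
  assumes "\<forall>\<^sub>\<approx>s. f s = g s" "continuous_on UNIV f" "continuous_on UNIV g"
  shows "f s = g s"
proof -
  have "norm (f s - g s) \<le> 0"
  proof (rule cosparse_le_imp_le[where S = UNIV and u = "\<lambda>s. norm (f s - g s)"])
    show "isCont (\<lambda>s. norm (f s - g s)) s"
      using assms by (intro continuous_intros) (auto simp: continuous_on_eq_continuous_at)
    show "\<forall>\<^sub>\<approx>s. s \<in> UNIV \<longrightarrow> norm (f s - g s) \<le> 0"
      using assms(1) by eventually_elim auto
  qed auto
  thus ?thesis by simp
qed

text \<open>\<open>remove_sings\<close> fixes a nicely meromorphic function, also at poles, where
  both values are 0. Its value at a point depends only on a punctured neighbourhood, so agreement
  off a sparse set suffices.\<close>

lemma nicely_meromorphic_eq_remove_sings: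
  assumes "f nicely_meromorphic_on UNIV" "\<forall>\<^sub>\<approx>s. f s = g s"
  shows "f s = remove_sings g s"
proof -
  have "is_pole f s \<and> f s = 0 \<or> f \<midarrow>s\<rightarrow> f s"
    using assms(1) by (simp add: nicely_meromorphic_on_def)
  hence "f s = remove_sings f s" by (metis remove_sings_eqI remove_sings_at_pole)
  also have "\<dots> = remove_sings g s"
    using assms(2) by (intro remove_sings_cong) (auto simp: eventually_cosparse_open_eq)
  finally show ?thesis .
qed

lemma nicely_meromorphic_nonzero_cosparse:
  assumes "f nicely_meromorphic_on UNIV" "f \<noteq> (\<lambda>_. 0)"
  shows "\<forall>\<^sub>\<approx>s. f s \<noteq> 0"
  using nicely_meromorphic_imp_constant_or_avoid[OF assms(1), of 0] assms(2) by auto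

lemma mero_mult_cosparse:
  assumes "f meromorphic_on UNIV" "g meromorphic_on UNIV"
  shows "mero_mult f g meromorphic_on UNIV" "\<forall>\<^sub>\<approx>s. mero_mult f g s = f s * g s"
  unfolding mero_mult_def
  by (intro remove_sings_meromorphic eventually_remove_sings_eq meromorphic_intros assms)+

lemma mero_quot_cosparse:
  assumes "f meromorphic_on UNIV" "g meromorphic_on UNIV"
  shows "mero_quot f g meromorphic_on UNIV" "\<forall>\<^sub>\<approx>s. mero_quot f g s = f s / g s"
  unfolding mero_quot_def
  by (intro remove_sings_meromorphic eventually_remove_sings_eq meromorphic_intros assms)+

lemma represented_by_ODS_common_halfplane:
  assumes "represented_by_ODS f" "represented_by_ODS g"
  shows "\<exists>\<sigma> a b. (\<forall>s. Re s > \<sigma> \<longrightarrow> (\<lambda>n. a (Suc n) * of_nat (Suc n) powr (-s)) sums f s) \<and>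
    (\<forall>s. Re s > \<sigma> \<longrightarrow> (\<lambda>n. b (Suc n) * of_nat (Suc n) powr (-s)) sums g s)"
proof -
  obtain a \<sigma> where a: "\<And>s. Re s > \<sigma> \<Longrightarrow> (\<lambda>n. a (Suc n) * of_nat (Suc n) powr (-s)) sums f s"
    using assms(1) unfolding represented_by_ODS_def by blast
  obtain b \<tau> where b: "\<And>s. Re s > \<tau> \<Longrightarrow> (\<lambda>n. b (Suc n) * of_nat (Suc n) powr (-s)) sums g s"
    using assms(2) unfolding represented_by_ODS_def by blast
  show ?thesis by (intro exI[of _ "max \<sigma> \<tau>"] exI[of _ a] exI[of _ b]) (use a b in auto)
qed

theorem theorem1:
  fixes \<gamma> :: "complex \<Rightarrow> complex" and k :: real
    and L Lstar :: "nat \<Rightarrow> complex \<Rightarrow> complex" and N :: "nat \<Rightarrow> real"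
  assumes "\<gamma> nicely_meromorphic_on UNIV"
    and "\<And>i. i \<in> {1, 2} \<Longrightarrow> L i nicely_meromorphic_on UNIV"
    and "\<And>i. i \<in> {1, 2} \<Longrightarrow> Lstar i nicely_meromorphic_on UNIV"
    and "\<And>i. i \<in> {1, 2} \<Longrightarrow> N i > 0"
    and "\<And>i s. i \<in> {1, 2} \<Longrightarrow>
           L i (of_real k - s) =
             mero_mult (\<lambda>s. of_real (N i) powr s) (mero_mult \<gamma> (Lstar i)) s"
    and "\<And>i. i \<in> {1, 2} \<Longrightarrow>
           \<exists>P :: complex poly. P \<noteq> 0 \<and> mero_mult (poly P) (L i) holomorphic_on UNIV \<and>
             finite_order_on (mero_mult (poly P) (L i)) UNIV"
    and "L 2 \<noteq> (\<lambda>_. 0)"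
    and "finite {z. is_pole (mero_quot (L 1) (L 2)) z}"
    and "represented_by_ODS (mero_quot (L 1) (L 2))"
    and "represented_by_ODS (mero_quot (Lstar 1) (Lstar 2))"
  shows "\<exists>(M :: nat) (a :: nat \<Rightarrow> complex). M > 0 \<and>
           (\<forall>s. L 1 s = mero_mult (\<lambda>s. \<Sum>u | u dvd M. a u / of_nat u powr s) (L 2) s)"
proof -
  define F where "F = mero_quot (L 1) (L 2)"
  define G where "G = mero_quot (Lstar 1) (Lstar 2)"
  have mero: "\<gamma> meromorphic_on UNIV" "L 1 meromorphic_on UNIV" "L 2 meromorphic_on UNIV"
    "Lstar 1 meromorphic_on UNIV" "Lstar 2 meromorphic_on UNIV"
    using assms(1-3) by (auto simp: nicely_meromorphic_on_def)
  have N: "N 1 > 0" "N 2 > 0" using assms(4) by auto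
  have F: "F meromorphic_on UNIV" "\<forall>\<^sub>\<approx>s. F s = L 1 s / L 2 s"
    unfolding F_def using mero_quot_cosparse[OF mero(2,3)] by auto
  have G: "\<forall>\<^sub>\<approx>s. G s = Lstar 1 s / Lstar 2 s"
    unfolding G_def using mero_quot_cosparse[OF mero(4,5)] by auto
  have L2: "\<forall>\<^sub>\<approx>s. L 2 s \<noteq> 0"
    using nicely_meromorphic_nonzero_cosparse assms(2,7) by blast
  have feq: "\<forall>\<^sub>\<approx>s. L i (of_real k - s) = of_real (N i) powr s * (\<gamma> s * Lstar i s)" if i: "i \<in> {1, 2}" for i
  proof -
    have powr: "(\<lambda>s. of_real (N i) powr s) meromorphic_on UNIV"
      using assms(4)[OF i] by (intro analytic_on_imp_meromorphic_on) (auto intro!: analytic_intros)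
    have "Lstar i meromorphic_on UNIV" using mero i by auto
    note \<gamma>L = mero_mult_cosparse[OF mero(1) this]
    show ?thesis
      using mero_mult_cosparse(2)[OF powr \<gamma>L(1)] \<gamma>L(2)
      by eventually_elim (simp add: assms(5)[OF i])
  qed
  have reflect: "\<forall>\<^sub>\<approx>s. F (of_real k - s) = of_real (N 1 / N 2) powr s * G s"
    using feq[of 1, simplified] feq[of 2, simplified] G
      cosparse_reflect[OF F(2), of "of_real k"] cosparse_reflect[OF L2, of "of_real k"]
  proof eventually_elim
    case (elim s)
    have "of_real (N 1 / N 2) powr s * of_real (N 2) powr s = (of_real (N 1 / N 2) * of_real (N 2) :: complex) powr s"
      using N by (intro powr_times_real[symmetric]) auto
    also have "of_real (N 1 / N 2) * of_real (N 2) = (of_real (N 1) :: complex)"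
      using N by simp
    finally have "of_real (N 1) powr s = of_real (N 1 / N 2) powr s * (of_real (N 2) powr s :: complex)" ..
    \<comment> \<open>Since \<open>L 2 (k - s)\<close> is nonzero, so are \<open>\<gamma> s\<close>
      and \<open>Lstar 2 s\<close>; hence \<open>\<gamma> s\<close> cancels in the quotient.\<close>
    thus ?case using elim by simp
  qed
  obtain R H where H: "R \<noteq> 0" "H holomorphic_on UNIV" "\<forall>\<^sub>\<approx>s. H s = poly R s * F s"
    using clear_finite_poles[OF _ F(1) order.refl] assms(8) unfolding F_def by blast
  \<comment> \<open>With \<open>f1 = P1 * L 1\<close> and \<open>f2 = P2 * L 2\<close>, clearing
    denominators in \<open>H = R * L 1 / L 2\<close> gives \<open>P1 * f2 * H = R * P2 * f1\<close>.
    So \<open>H\<close> is an entire quotient of functions of finite order.\<close>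
  have H_growth: "exp_poly_growth H"
  proof -
    obtain P1 where P1: "P1 \<noteq> 0" "mero_mult (poly P1) (L 1) holomorphic_on UNIV"
        "finite_order_on (mero_mult (poly P1) (L 1)) UNIV"
      using assms(6)[of 1] by auto
    obtain P2 where P2: "P2 \<noteq> 0" "mero_mult (poly P2) (L 2) holomorphic_on UNIV"
        "finite_order_on (mero_mult (poly P2) (L 2)) UNIV"
      using assms(6)[of 2] by auto
    define f1 f2 where "f1 = mero_mult (poly P1) (L 1)" and "f2 = mero_mult (poly P2) (L 2)"
    have holo: "f1 holomorphic_on UNIV" "f2 holomorphic_on UNIV" using P1 P2 by (auto simp: f1_def f2_def)
    have growth: "exp_poly_growth f1" "exp_poly_growth f2"
      using P1 P2 finite_order_on_imp_exp_poly_growth by (auto simp: f1_def f2_def)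
    have poly_mero: "poly P meromorphic_on UNIV" for P :: "complex poly"
      by (intro analytic_on_imp_meromorphic_on) (auto simp: analytic_on_open intro!: holomorphic_intros)
    have f1: "\<forall>\<^sub>\<approx>s. f1 s = poly P1 s * L 1 s"
      unfolding f1_def by (intro mero_mult_cosparse poly_mero mero)
    have f2: "\<forall>\<^sub>\<approx>s. f2 s = poly P2 s * L 2 s"
      unfolding f2_def by (intro mero_mult_cosparse poly_mero mero)
    have "\<forall>\<^sub>\<approx>s. poly P1 s * f2 s \<noteq> 0"
      using cosparse_poly_nonzero[OF P1(1)] cosparse_poly_nonzero[OF P2(1)] f2 L2
      by eventually_elim simp
    then obtain z0 where "poly P1 z0 * f2 z0 \<noteq> 0" using cosparse_UNIV_happens by blast
    moreover have "poly P1 s * f2 s * H s = poly (R * P2) s * f1 s" for s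
    proof (rule continuous_cosparse_eq_imp_eq[where f = "\<lambda>s. poly P1 s * f2 s * H s"
          and g = "\<lambda>s. poly (R * P2) s * f1 s"])
      show "\<forall>\<^sub>\<approx>s. poly P1 s * f2 s * H s = poly (R * P2) s * f1 s"
        using f1 f2 H(3) F(2) L2 by eventually_elim simp
      show "continuous_on UNIV (\<lambda>s. poly P1 s * f2 s * H s)" "continuous_on UNIV (\<lambda>s. poly (R * P2) s * f1 s)"
        by (intro continuous_intros holomorphic_on_imp_continuous_on holo H)+
    qed
    hence "exp_poly_growth (\<lambda>s. poly P1 s * f2 s * H s)"
      using exp_poly_growth_mult[OF exp_poly_growth_poly[of "R * P2"] growth(1)] by (simp only:)
    moreover have "(\<lambda>s. poly P1 s * f2 s) holomorphic_on UNIV"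
      by (intro holomorphic_intros holo)
    moreover have "exp_poly_growth (\<lambda>s. poly P1 s * f2 s)"
      by (intro exp_poly_growth_mult exp_poly_growth_poly growth)
    ultimately show ?thesis using exp_poly_growth_quotient[OF _ H(2)] by blast
  qed
  obtain a b \<sigma> where
    ab: "\<forall>s. Re s > \<sigma> \<longrightarrow> (\<lambda>n. a (Suc n) * of_nat (Suc n) powr (-s)) sums F s"
      "\<forall>s. Re s > \<sigma> \<longrightarrow> (\<lambda>n. b (Suc n) * of_nat (Suc n) powr (-s)) sums G s"
    using represented_by_ODS_common_halfplane[OF assms(9,10), folded F_def G_def] by blast
  have "N 1 / N 2 > 0" using N by simp
  interpret S: reflected_dirichlet_series F G H R "N 1 / N 2" k \<sigma> a b
    by unfold_locales (use ab in blast, use ab in blast, fact+)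
  obtain M c where M: "M > 0" "\<forall>\<^sub>\<approx>s. F s = (\<Sum>u | u dvd M. c u / of_nat u powr s)"
    using S.F_eq_divisor_sum by blast
  have "\<forall>\<^sub>\<approx>s. L 1 s = (\<Sum>u | u dvd M. c u / of_nat u powr s) * L 2 s"
    using M(2) F(2) L2 by eventually_elim (metis nonzero_eq_divide_eq)
  hence "L 1 s = mero_mult (\<lambda>s. \<Sum>u | u dvd M. c u / of_nat u powr s) (L 2) s" for s
    unfolding mero_mult_def using assms(2)[of 1] by (intro nicely_meromorphic_eq_remove_sings) auto
  thus ?thesis using M(1) by blast
qed

end
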